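(* Let $\Omega=\{(i_\ell,j_\ell)\}_{\ell=1}^m\subset[d_1]\times[d_2]$ consist of $m$ distinct index pairs, let $\mathbf{y}\in\mathbb{R}^m$, and let $D=\max(d_1,d_2)$. Let $\mathbf{X}^{(k)}\in\mathbb{R}^{d_1\times d_2}$ be the $k$-th iterate of the algorithm MatrixIRLS (described in the context) for the observation vector $\mathbf{y}$ and rank estimate $\widetilde r=r$. Assume that $\sigma_i(\mathbf{X}^{(k)})\le\epsilon_k$ for all $i>r$ and $\sigma_r(\mathbf{X}^{(k)})>\epsilon_k$. Then an implicit representation of the new iterate $\mathbf{X}^{(k+1)}\in\mathbb{R}^{d_1\times d_2}$ can be calculated in a time complexity of $$O\big((mr+r^2D)\cdot N_{\mathrm{CG\_inner}}\big),$$ where $N_{\mathrm{CG\_inner}}$ is the number of inner iterations used in the conjugate gradient method. More precisely, $\mathbf{X}^{(k+1)}$ can be represented as $$\mathbf{X}^{(k+1)}=P_\Omega^*(\mathbf{r}_{k+1})+\mathbf{U}^{(k)}\mathbf{M}_1^{(k+1)*}+\mathbf{M}_2^{(k+1)}\mathbf{V}^{(k)*},$$ where $\mathbf{r}_{k+1}\in\mathbb{R}^m$, $\mathbf{M}_1^{(k+1)}\in\mathbb{R}^{d_2\times r}$ and $\mathbf{M}_2^{(k+1)}\in\mathbb{R}^{d_1\times r}$, i.e., with a space complexity of $O(m+rD)$. Here $\mathbf{U}^{(k)}\in\mathbb{R}^{d_1\times r}$ and $\mathbf{V}^{(k)}\in\mathbb{R}^{d_2\times r}$ contain the leading $r$ left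 and right singular vectors of $\mathbf{X}^{(k)}$.
   Context: Notation: $d=\min(d_1,d_2)$; $\sigma_i(\mathbf{X})$ is the $i$-th largest singular value (with $\sigma_i(\mathbf{X})=0$ for $i>d$); $P_\Omega:\mathbb{R}^{d_1\times d_2}\to\mathbb{R}^m$, $P_\Omega(\mathbf{X})_\ell=\mathbf{X}_{i_\ell j_\ell}$, with adjoint $P_\Omega^*$; $^*$ on matrices is transposition; $\circ$ is the entrywise product; $\langle\cdot,\cdot\rangle$ is the Frobenius inner product. Weight operator: given $\epsilon_k>0$ and $\mathbf{X}^{(k)}$ with full singular value decomposition $\mathbf{X}^{(k)}=\mathbf{U}_k\,\mathrm{dg}(\sigma^{(k)})\mathbf{V}_k^*$ ($\mathbf{U}_k\in\mathbb{R}^{d_1\times d_1}$, $\mathbf{V}_k\in\mathbb{R}^{d_2\times d_2}$ orthogonal, $\mathrm{dg}(\sigma)$ the $d_1\times d_2$ matrix with $\sigma$ on its diagonal), set $(\mathbf{H}_k)_{ij}=\big(\max(\sigma_i^{(k)},\epsilon_k)\max(\sigma_j^{(k)},\epsilon_k)\big)^{-1}$ and $W^{(k)}(\mathbf{Z})=\mathbf{U}_k[\mathbf{H}_k\circ(\mathbf{U}_k^*\mathbf{Z}\mathbf{V}_k)]\mathbf{V}_k^*$. MatrixIRLS with input $\Omega,\mathbf{y},\widetilde r$: start with $\epsilon_0=\infty$, $W^{(0)}=\mathrm{Id}$. For $k=1,2,\dots$: (1) $\mathbf{X}^{(k)}=\arg\min_{\mathbf{X}:P_\Omega(\mathbf{X})=\mathbf{y}}\langle\mathbf{X},W^{(k-1)}(\mathbf{X})\rangle$,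 solved by a conjugate gradient (CG) method; (2) $\epsilon_k=\min(\epsilon_{k-1},\sigma_{\widetilde r+1}(\mathbf{X}^{(k)}))$; (3) with $r_k=|\{i\in[d]:\sigma_i(\mathbf{X}^{(k)})>\epsilon_k\}|$, compute the first $r_k$ singular values and leading left/right singular vectors $\mathbf{U}^{(k)},\mathbf{V}^{(k)}$ of $\mathbf{X}^{(k)}$, which determine $W^{(k)}$. It is presupposed that $\epsilon_k>0$ whenever $W^{(k)}$ is used. The step producing $\mathbf{X}^{(k+1)}$ takes as given $\Omega$, $\mathbf{y}$, $\epsilon_k$, the leading $r_k$ singular values $\sigma_1^{(k)},\dots,\sigma_{r_k}^{(k)}$, and $\mathbf{U}^{(k)},\mathbf{V}^{(k)}$ (and an initial vector for CG). CG is applied to the following positive definite linear system. Let $u_i,v_j$ be the columns of $\mathbf{U}_k,\mathbf{V}_k$, let $T_k=\mathrm{span}\{u_iv_j^*: i\le r_k\text{ or }j\le r_k\}$, let $S_k=\mathbb{R}^{r_k(d_1+d_2-r_k)}$, let $P_{T_k}:S_k\to T_k\subset\mathbb{R}^{d_1\times d_2}$ map coordinates to the corresponding linear combination of this orthonormal basis of $T_k$, and let $\mathbf{D}_{S_k}$ be the diagonal operator on $S_k$ whose entry for $u_iv_j^*$ is $(\mathbf{H}_k)_{ij}$. The system matrix is $\epsilon_k^2(\mathbf{D}_{S_k}^{-1}-\epsilon_k^2\mathbf{I}_{S_k})^{-1}+P_{T_k}^*P_\Omega^*P_\Omega P_{T_k}$, with unknown $\gamma_k\in S_k$ and right-hand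 side $P_{T_k}^*P_\Omega^*(\mathbf{y})$ (or the equivalent residual system for a correction to the initial vector). Any equivalent intrinsic parametrization of $T_k$ by orthonormal coordinates may be used for $S_k$. Time complexity counts arithmetic operations; space complexity counts stored real numbers. *)

theory Defs
  imports "HOL-Library.Extended_Real" "Jordan_Normal_Form.Matrix"
begin

text \<open>
  All indices are 0-based: the singular value number \<open>i\<close> of the mathematical text is \<open>s (i - 1)\<close>.
\<close>

section \<open>Matrices, singular value decomposition, sampling\<close>

definition frob_inner :: "real mat \<Rightarrow> real mat \<Rightarrow> real" where
  "frob_inner A B = (\<Sum>i<dim_row A. \<Sum>j<dim_col A. A $$ (i,j) * B $$ (i,j))"

definition dg :: "nat \<Rightarrow> nat \<Rightarrow> (nat \<Rightarrow> real) \<Rightarrow> real mat" where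
  "dg d1 d2 s = mat d1 d2 (\<lambda>(i,j). if i = j then s i else 0)"

definition orthogonal_matrix :: "nat \<Rightarrow> real mat \<Rightarrow> bool" where
  "orthogonal_matrix n Q \<longleftrightarrow> Q \<in> carrier_mat n n \<and> Q\<^sup>T * Q = 1\<^sub>m n"

text \<open>Full singular value decomposition; \<open>s\<close> is padded by zeros beyond \<open>min d1 d2\<close>.\<close>

definition is_svd ::
  "nat \<Rightarrow> nat \<Rightarrow> real mat \<Rightarrow> real mat \<Rightarrow> (nat \<Rightarrow> real) \<Rightarrow> real mat \<Rightarrow> bool" where
  "is_svd d1 d2 X U s V \<longleftrightarrow>
     orthogonal_matrix d1 U \<and> orthogonal_matrix d2 V \<and>
     antimono s \<and> (\<forall>i. 0 \<le> s i) \<and> (\<forall>i \<ge> min d1 d2. s i = 0) \<and>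
     X = U * dg d1 d2 s * V\<^sup>T"

definition first_cols :: "nat \<Rightarrow> real mat \<Rightarrow> real mat" where
  "first_cols r A = mat (dim_row A) r (\<lambda>(i,j). A $$ (i,j))"

definition sample :: "(nat \<times> nat) list \<Rightarrow> real mat \<Rightarrow> real vec" where
  "sample \<Omega> X = vec (length \<Omega>) (\<lambda>l. X $$ (\<Omega> ! l))"

definition sample_adj :: "nat \<Rightarrow> nat \<Rightarrow> (nat \<times> nat) list \<Rightarrow> real vec \<Rightarrow> real mat" where
  "sample_adj d1 d2 \<Omega> w =
     mat d1 d2 (\<lambda>ij. \<Sum>l<length \<Omega>. if \<Omega> ! l = ij then w $ l else 0)"

section \<open>MatrixIRLS\<close>

definition weight :: "real \<Rightarrow> (nat \<Rightarrow> real) \<Rightarrow> nat \<Rightarrow> nat \<Rightarrow> real" where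
  "weight e s i j = inverse (max (s i) e * max (s j) e)"

definition weight_op ::
  "nat \<Rightarrow> nat \<Rightarrow> real \<Rightarrow> real mat \<Rightarrow> (nat \<Rightarrow> real) \<Rightarrow> real mat \<Rightarrow> real mat \<Rightarrow> real mat" where
  "weight_op d1 d2 e U s V Z =
     U * mat d1 d2 (\<lambda>(i,j). weight e s i j * (U\<^sup>T * Z * V) $$ (i,j)) * V\<^sup>T"

definition wls_minimizer ::
  "nat \<Rightarrow> nat \<Rightarrow> (nat \<times> nat) list \<Rightarrow> real vec \<Rightarrow> (real mat \<Rightarrow> real mat) \<Rightarrow> real mat \<Rightarrow> bool" where
  "wls_minimizer d1 d2 \<Omega> y W X \<longleftrightarrow>
     is_arg_min (\<lambda>Z. frob_inner Z (W Z)) (\<lambda>Z. Z \<in> carrier_mat d1 d2 \<and> sample \<Omega> Z = y) X"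

text \<open>
  \<open>X 1, \<dots>, X (k + 1)\<close> are iterates of MatrixIRLS with rank estimate \<open>rt\<close>;
  \<open>eps 0 = \<infinity>\<close> encodes the initial smoothing parameter, and \<open>U j\<close>, \<open>s j\<close>, \<open>V j\<close> is an
  arbitrary choice of singular value decomposition of \<open>X j\<close>.  Positivity of \<open>eps j\<close> is
  required exactly for those \<open>j\<close> whose weight operator is used.
\<close>

definition matrix_irls ::
  "nat \<Rightarrow> nat \<Rightarrow> (nat \<times> nat) list \<Rightarrow> real vec \<Rightarrow> nat \<Rightarrow> nat \<Rightarrow> (nat \<Rightarrow> real mat) \<Rightarrow>
   (nat \<Rightarrow> ereal) \<Rightarrow> (nat \<Rightarrow> real mat) \<Rightarrow> (nat \<Rightarrow> nat \<Rightarrow> real) \<Rightarrow> (nat \<Rightarrow> real mat) \<Rightarrow> bool" where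
  "matrix_irls d1 d2 \<Omega> y rt k X eps U s V \<longleftrightarrow>
     eps 0 = \<infinity> \<and> wls_minimizer d1 d2 \<Omega> y (\<lambda>Z. Z) (X 1) \<and>
     (\<forall>j\<in>{1..k}.
        is_svd d1 d2 (X j) (U j) (s j) (V j) \<and>
        eps j = min (eps (j - 1)) (ereal (s j rt)) \<and>
        0 < eps j \<and>
        wls_minimizer d1 d2 \<Omega> y
          (weight_op d1 d2 (real_of_ereal (eps j)) (U j) (s j) (V j)) (X (j + 1)))"

section \<open>The linear system on the tangent space and the conjugate gradient method\<close>

definition num_above :: "nat \<Rightarrow> nat \<Rightarrow> real \<Rightarrow> (nat \<Rightarrow> real) \<Rightarrow> nat" where
  "num_above d1 d2 e s = card {i. i < min d1 d2 \<and> e < s i}"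

text \<open>
  The coordinate space \<open>S\<close> consists of real families indexed by the pairs \<open>(i,j)\<close> of the
  orthonormal basis \<open>u\<^sub>i v\<^sub>j\<^sup>T\<close> of \<open>T\<close>; values outside the index set are irrelevant.
\<close>

definition tangent_idx :: "nat \<Rightarrow> nat \<Rightarrow> nat \<Rightarrow> (nat \<times> nat) set" where
  "tangent_idx d1 d2 r = {(i,j). i < d1 \<and> j < d2 \<and> (i < r \<or> j < r)}"

definition tangent_map ::
  "nat \<Rightarrow> nat \<Rightarrow> nat \<Rightarrow> real mat \<Rightarrow> real mat \<Rightarrow> (nat \<times> nat \<Rightarrow> real) \<Rightarrow> real mat" where
  "tangent_map d1 d2 r U V \<gamma> =
     mat d1 d2 (\<lambda>(a,b). \<Sum>(i,j)\<in>tangent_idx d1 d2 r. \<gamma> (i,j) * (U $$ (a,i) * V $$ (b,j)))"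

definition tangent_adj :: "real mat \<Rightarrow> real mat \<Rightarrow> real mat \<Rightarrow> nat \<times> nat \<Rightarrow> real" where
  "tangent_adj U V Z = (\<lambda>(i,j). \<Sum>a<dim_row U. \<Sum>b<dim_row V. U $$ (a,i) * V $$ (b,j) * Z $$ (a,b))"

definition system_op ::
  "nat \<Rightarrow> nat \<Rightarrow> (nat \<times> nat) list \<Rightarrow> nat \<Rightarrow> real \<Rightarrow> real mat \<Rightarrow> (nat \<Rightarrow> real) \<Rightarrow> real mat \<Rightarrow>
   (nat \<times> nat \<Rightarrow> real) \<Rightarrow> (nat \<times> nat \<Rightarrow> real)" where
  "system_op d1 d2 \<Omega> r e U s V \<gamma> = (\<lambda>(i,j).
     e\<^sup>2 * inverse (inverse (weight e s i j) - e\<^sup>2) * \<gamma> (i,j) +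
     tangent_adj U V (sample_adj d1 d2 \<Omega> (sample \<Omega> (tangent_map d1 d2 r U V \<gamma>))) (i,j))"

definition system_rhs ::
  "nat \<Rightarrow> nat \<Rightarrow> (nat \<times> nat) list \<Rightarrow> real vec \<Rightarrow> real mat \<Rightarrow> real mat \<Rightarrow> nat \<times> nat \<Rightarrow> real" where
  "system_rhs d1 d2 \<Omega> y U V = tangent_adj U V (sample_adj d1 d2 \<Omega> y)"

definition coord_inner :: "'i set \<Rightarrow> ('i \<Rightarrow> real) \<Rightarrow> ('i \<Rightarrow> real) \<Rightarrow> real" where
  "coord_inner I x z = (\<Sum>i\<in>I. x i * z i)"

text \<open>
  State (iterate, residual, search direction) after a number of inner iterations.  Since
  \<open>0 / 0 = 0\<close>, the iterate no longer changes once the residual has vanished.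
\<close>

primrec cg_state ::
  "'i set \<Rightarrow> (('i \<Rightarrow> real) \<Rightarrow> 'i \<Rightarrow> real) \<Rightarrow> ('i \<Rightarrow> real) \<Rightarrow> ('i \<Rightarrow> real) \<Rightarrow> nat \<Rightarrow>
   ('i \<Rightarrow> real) \<times> ('i \<Rightarrow> real) \<times> ('i \<Rightarrow> real)" where
  "cg_state I A b x0 0 = (x0, (\<lambda>i. b i - A x0 i), (\<lambda>i. b i - A x0 i))"
| "cg_state I A b x0 (Suc n) =
    (let (x, q, p) = cg_state I A b x0 n;
         \<alpha> = coord_inner I q q / coord_inner I p (A p);
         q' = (\<lambda>i. q i - \<alpha> * A p i);
         \<beta> = coord_inner I q' q' / coord_inner I q q
     in ((\<lambda>i. x i + \<alpha> * p i), q', (\<lambda>i. q' i + \<beta> * p i)))"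

definition cg_iterate ::
  "'i set \<Rightarrow> (('i \<Rightarrow> real) \<Rightarrow> 'i \<Rightarrow> real) \<Rightarrow> ('i \<Rightarrow> real) \<Rightarrow> ('i \<Rightarrow> real) \<Rightarrow> nat \<Rightarrow> 'i \<Rightarrow> real" where
  "cg_iterate I A b x0 n = fst (cg_state I A b x0 n)"

text \<open>
  The matrix obtained from a (possibly inexact) solution \<open>\<gamma>\<close> of the system:
  the element of \<open>T\<close> with coordinates \<open>\<gamma>\<close>, corrected on the sampled entries so that the
  data are fitted exactly.
\<close>

definition matrix_of_coords ::
  "nat \<Rightarrow> nat \<Rightarrow> (nat \<times> nat) list \<Rightarrow> real vec \<Rightarrow> nat \<Rightarrow> real mat \<Rightarrow> real mat \<Rightarrow>
   (nat \<times> nat \<Rightarrow> real) \<Rightarrow> real mat" where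
  "matrix_of_coords d1 d2 \<Omega> y r U V \<gamma> =
     sample_adj d1 d2 \<Omega> (y - sample \<Omega> (tangent_map d1 d2 r U V \<gamma>)) + tangent_map d1 d2 r U V \<gamma>"

section \<open>A real random access machine with unit costs\<close>

text \<open>
  Programs have natural number registers (sizes and loop counters), read-only arrays of natural
  numbers (the sampled positions) and two-dimensional arrays of reals.  Integer literals are the
  only real constants.  Every node of an evaluated expression, every assignment and every loop
  iteration costs one unit, so the running time bounds the number of arithmetic operations.
  The division of the machine is the total one, \<open>x / 0 = 0\<close>.
\<close>

datatype iexp = Reg string | ILit nat | Lookup string iexp

datatype rexp =
    RLit int
  | Cell string iexp iexp
  | Add rexp rexp
  | Sub rexp rexp
  | Mul rexp rexp
  | Div rexp rexp

datatype cmd =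
    Store string iexp iexp rexp
  | Seq cmd cmd
  | For string iexp cmd  \<comment> \<open>the register runs through \<open>0, \<dots>, n - 1\<close>, with \<open>n\<close> evaluated once\<close>

text \<open>\<open>cells\<close> collects the addresses of all real numbers that have been stored so far.\<close>

record mstate =
  regs :: "string \<Rightarrow> nat"
  iarr :: "string \<Rightarrow> nat \<Rightarrow> nat"
  rarr :: "string \<Rightarrow> nat \<Rightarrow> nat \<Rightarrow> real"
  cells :: "(string \<times> nat \<times> nat) set"
  steps :: nat

primrec ival :: "mstate \<Rightarrow> iexp \<Rightarrow> nat" where
  "ival st (Reg x) = regs st x"
| "ival st (ILit n) = n"
| "ival st (Lookup a e) = iarr st a (ival st e)"

primrec icost :: "iexp \<Rightarrow> nat" where
  "icost (Reg x) = 1"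
| "icost (ILit n) = 1"
| "icost (Lookup a e) = 1 + icost e"

primrec rval :: "mstate \<Rightarrow> rexp \<Rightarrow> real" where
  "rval st (RLit z) = of_int z"
| "rval st (Cell a e f) = rarr st a (ival st e) (ival st f)"
| "rval st (Add p q) = rval st p + rval st q"
| "rval st (Sub p q) = rval st p - rval st q"
| "rval st (Mul p q) = rval st p * rval st q"
| "rval st (Div p q) = rval st p / rval st q"

primrec rcost :: "rexp \<Rightarrow> nat" where
  "rcost (RLit z) = 1"
| "rcost (Cell a e f) = 1 + icost e + icost f"
| "rcost (Add p q) = 1 + rcost p + rcost q"
| "rcost (Sub p q) = 1 + rcost p + rcost q"
| "rcost (Mul p q) = 1 + rcost p + rcost q"
| "rcost (Div p q) = 1 + rcost p + rcost q"

definition store :: "string \<Rightarrow> nat \<Rightarrow> nat \<Rightarrow> real \<Rightarrow> mstate \<Rightarrow> mstate" where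
  "store a i j v st = st
     \<lparr> rarr := (\<lambda>b k l. if b = a \<and> k = i \<and> l = j then v else rarr st b k l),
       cells := insert (a, i, j) (cells st) \<rparr>"

definition tick :: "nat \<Rightarrow> mstate \<Rightarrow> mstate" where
  "tick n st = st \<lparr> steps := steps st + n \<rparr>"

primrec run :: "cmd \<Rightarrow> mstate \<Rightarrow> mstate" where
  "run (Store a e f p) st =
     tick (1 + icost e + icost f + rcost p) (store a (ival st e) (ival st f) (rval st p) st)"
| "run (Seq c d) st = run d (run c st)"
| "run (For x e c) st =
     fold (\<lambda>i st'. run c (tick 1 (st' \<lparr> regs := (regs st')(x := i) \<rparr>))) [0..<ival st e]
       (tick (1 + icost e) st)"

definition holds_mat :: "mstate \<Rightarrow> string \<Rightarrow> real mat \<Rightarrow> bool" where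
  "holds_mat st a A \<longleftrightarrow> (\<forall>i<dim_row A. \<forall>j<dim_col A. rarr st a i j = A $$ (i,j))"

definition holds_vec :: "mstate \<Rightarrow> string \<Rightarrow> real vec \<Rightarrow> bool" where
  "holds_vec st a v \<longleftrightarrow> (\<forall>i<dim_vec v. rarr st a i 0 = v $ i)"

definition read_mat :: "mstate \<Rightarrow> string \<Rightarrow> nat \<Rightarrow> nat \<Rightarrow> real mat" where
  "read_mat st a n l = mat n l (\<lambda>(i,j). rarr st a i j)"

definition read_vec :: "mstate \<Rightarrow> string \<Rightarrow> nat \<Rightarrow> real vec" where
  "read_vec st a n = vec n (\<lambda>i. rarr st a i 0)"

definition block :: "string \<Rightarrow> nat \<Rightarrow> nat \<Rightarrow> (string \<times> nat \<times> nat) set" where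
  "block a n l = {a} \<times> {..<n} \<times> {..<l}"

text \<open>
  Input of one MatrixIRLS step with \<open>N\<close> inner iterations: the sampled positions, the data, the
  smoothing parameter, the leading \<open>r\<close> singular values and vectors, and factors \<open>A0\<close>, \<open>B0\<close> of the
  element \<open>Ur A0\<^sup>T + B0 Vr\<^sup>T\<close> of \<open>T\<close> that represents the initial vector.  Nothing is assumed about
  the memory outside the input.
\<close>

definition step_input ::
  "nat \<Rightarrow> nat \<Rightarrow> nat \<Rightarrow> nat \<Rightarrow> (nat \<times> nat) list \<Rightarrow> real vec \<Rightarrow> real \<Rightarrow> (nat \<Rightarrow> real) \<Rightarrow>
   real mat \<Rightarrow> real mat \<Rightarrow> real mat \<Rightarrow> real mat \<Rightarrow> mstate \<Rightarrow> bool" where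
  "step_input d1 d2 r N \<Omega> y e s Ur Vr A0 B0 st \<longleftrightarrow>
     regs st ''d1'' = d1 \<and> regs st ''d2'' = d2 \<and> regs st ''m'' = length \<Omega> \<and>
     regs st ''r'' = r \<and> regs st ''N'' = N \<and>
     (\<forall>l<length \<Omega>. iarr st ''row'' l = fst (\<Omega> ! l) \<and> iarr st ''col'' l = snd (\<Omega> ! l)) \<and>
     holds_vec st ''y'' y \<and> rarr st ''eps'' 0 0 = e \<and> holds_vec st ''sigma'' (vec r s) \<and>
     holds_mat st ''U'' Ur \<and> holds_mat st ''V'' Vr \<and>
     holds_mat st ''A0'' A0 \<and> holds_mat st ''B0'' B0 \<and>
     cells st = block ''y'' (length \<Omega>) 1 \<union> block ''eps'' 1 1 \<union> block ''sigma'' r 1 \<union>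
       block ''U'' d1 r \<union> block ''V'' d2 r \<union> block ''A0'' d2 r \<union> block ''B0'' d1 r \<and>
     steps st = 0"

end

theory Submission
  imports Defs "Jordan_Normal_Form.Determinant"
begin

text \<open>
  In the coordinates \<open>u\<^sub>i\<^sup>T Z v\<^sub>j\<close> the weight operator is diagonal with entries \<open>H\<close>, constant
  \<open>e\<^sup>-\<^sup>2\<close> off the tangent space \<open>T\<close>.  A minimizer \<open>X\<close> satisfies \<open>W X = P\<^sup>* \<lambda>\<close>, hence
  \<open>X - e\<^sup>2 P\<^sup>* \<lambda> \<in> T\<close>, and elements of \<open>T\<close> have the form \<open>U\<^sub>r M\<^sub>1\<^sup>T + M\<^sub>2 V\<^sub>r\<^sup>T\<close>.
  Conversely, if \<open>\<gamma>\<close> solves the system, then the matrix built from it is feasible and is mapped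
  by \<open>W\<close> into the range of \<open>P\<^sup>*\<close>, so by strict convexity it is the minimizer.

  The trailing singular vectors are not part of the input, so conjugate gradients cannot run on
  the coordinates themselves.  They run on an isometric parametrization: \<open>Z \<in> T\<close> is
  \<open>U\<^sub>r G V\<^sub>r\<^sup>T + U\<^sub>r A\<^sup>T + B V\<^sub>r\<^sup>T\<close> with \<open>V\<^sub>r\<^sup>T A = 0\<close> and \<open>U\<^sub>r\<^sup>T B = 0\<close>.  As
  \<open>\<sigma>\<^sub>i \<le> e\<close> for the trailing indices, the diagonal part of the system acts on \<open>G\<close> entrywise and on
  \<open>A\<close>, \<open>B\<close> columnwise, and the sampling part costs \<open>O(m r + r\<^sup>2 D)\<close> operations.
\<close>

section \<open>Static analysis of programs\<close>

text \<open>One program and one constant have to serve all dimensions, ranks and iteration counts.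
  Both resource bounds are therefore read off the program text: no loop bound depends on a loop
  counter or on real data, so the cost is a polynomial with fixed coefficients in the loop bounds,
  and only its monomials have to be compared with the claim.

  Conjugate gradients touch the coordinates only through the operator, linear combinations and inner
  products. The parametrization respects all three, so the scalars of each inner iteration, and
  hence every iterate, are those of the coordinate version, although the coordinates are never
  computed. Machine and logic divide by zero in the same way, so a vanished residual needs no
  separate case.

  Core and right factor share the left factor \<open>U_r\<close>. Merging them once per application
  turns each sampled entry into two inner products of length \<open>r\<close>, in place of a
  bilinear form of size \<open>r\<close> by \<open>r\<close>; this is why the samples contribute
  \<open>m r\<close> and the merging only \<open>r^2 D\<close>.\<close>

primrec iregs :: "iexp \<Rightarrow> string set" where
  "iregs (Reg x) = {x}"
| "iregs (ILit n) = {}"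
| "iregs (Lookup a e) = iregs e"

primrec rreads :: "rexp \<Rightarrow> string set" where
  "rreads (RLit z) = {}"
| "rreads (Cell a e f) = {a}"
| "rreads (Add p q) = rreads p \<union> rreads q"
| "rreads (Sub p q) = rreads p \<union> rreads q"
| "rreads (Mul p q) = rreads p \<union> rreads q"
| "rreads (Div p q) = rreads p \<union> rreads q"

primrec lregs :: "cmd \<Rightarrow> string set" where
  "lregs (Store a e f p) = {}"
| "lregs (Seq c d) = lregs c \<union> lregs d"
| "lregs (For x e c) = insert x (lregs c)"

primrec bregs :: "cmd \<Rightarrow> string set" where
  "bregs (Store a e f p) = {}"
| "bregs (Seq c d) = bregs c \<union> bregs d"
| "bregs (For x e c) = iregs e \<union> bregs c"

primrec writes :: "cmd \<Rightarrow> string set" where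
  "writes (Store a e f p) = {a}"
| "writes (Seq c d) = writes c \<union> writes d"
| "writes (For x e c) = writes c"

text \<open>All loop bounds are evaluated in one and the same state, so the value is a polynomial in
  them. \<open>steps_run\<close> justifies this for programs whose loop bounds mention no loop
  counter.\<close>

primrec static_cost :: "mstate \<Rightarrow> cmd \<Rightarrow> nat" where
  "static_cost st (Store a e f p) = 1 + icost e + icost f + rcost p"
| "static_cost st (Seq c d) = static_cost st c + static_cost st d"
| "static_cost st (For x e c) = 1 + icost e + ival st e * (1 + static_cost st c)"

lemma ival_cong:
  "(\<And>x. x \<in> iregs e \<Longrightarrow> regs st x = regs st' x) \<Longrightarrow> iarr st = iarr st' \<Longrightarrow> ival st e = ival st' e"
  by (induction e) auto

lemma rval_cong:
  "regs st = regs st' \<Longrightarrow> iarr st = iarr st' \<Longrightarrow>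
   (\<And>a. a \<in> rreads p \<Longrightarrow> rarr st a = rarr st' a) \<Longrightarrow> rval st p = rval st' p"
proof (induction p)
  case (Cell a e f)
  then show ?case using ival_cong[of e st st'] ival_cong[of f st st'] by simp
qed auto

lemma tick_simps [simp]:
  "regs (tick n st) = regs st" "iarr (tick n st) = iarr st" "rarr (tick n st) = rarr st"
  "cells (tick n st) = cells st" "steps (tick n st) = steps st + n"
  by (auto simp: tick_def)

lemma store_simps [simp]:
  "regs (store a i j v st) = regs st" "iarr (store a i j v st) = iarr st"
  "rarr (store a i j v st) = (\<lambda>b k l. if b = a \<and> k = i \<and> l = j then v else rarr st b k l)"
  "cells (store a i j v st) = insert (a, i, j) (cells st)" "steps (store a i j v st) = steps st"
  by (auto simp: store_def)

section \<open>Loop rule, frame properties and exact running time\<close>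

lemma run_For_induct [consumes 0, case_names init step]:
  assumes "P 0 (tick (1 + icost e) st)"
    and "\<And>v st'. v < ival st e \<Longrightarrow> P v st' \<Longrightarrow>
           P (Suc v) (run c (tick 1 (st' \<lparr> regs := (regs st')(x := v) \<rparr>)))"
  shows "P (ival st e) (run (For x e c) st)"
proof -
  let ?step = "\<lambda>i st'. run c (tick 1 (st' \<lparr> regs := (regs st')(x := i) \<rparr>))"
  have "n \<le> ival st e \<Longrightarrow> P n (fold ?step [0..<n] (tick (1 + icost e) st))" for n
    by (induction n) (use assms in auto)
  then show ?thesis by simp
qed

lemma iarr_run [simp]: "iarr (run c st) = iarr st"
proof (induction c arbitrary: st)
  case (For x e c)
  show ?case
    by (rule run_For_induct[where P = "\<lambda>_ st'. iarr st' = iarr st"]) (use For in auto)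
qed auto

lemma regs_run: "y \<notin> lregs c \<Longrightarrow> regs (run c st) y = regs st y"
proof (induction c arbitrary: st)
  case (For x e c)
  show ?case
    by (rule run_For_induct[where P = "\<lambda>_ st'. regs st' y = regs st y"]) (use For in auto)
qed auto

lemma rarr_run: "b \<notin> writes c \<Longrightarrow> rarr (run c st) b = rarr st b"
proof (induction c arbitrary: st)
  case (For x e c)
  show ?case
    by (rule run_For_induct[where P = "\<lambda>_ st'. rarr st' b = rarr st b"]) (use For in auto)
qed auto

lemma static_cost_cong:
  "(\<And>x. x \<in> bregs c \<Longrightarrow> regs st x = regs st' x) \<Longrightarrow> iarr st = iarr st' \<Longrightarrow>
   static_cost st c = static_cost st' c"
proof (induction c)
  case (For x e c)
  then show ?case using ival_cong[of e st st'] by auto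
next
  case (Seq c d)
  then show ?case by (metis UnCI bregs.simps(2) static_cost.simps(2))
qed auto

text \<open>Loop bounds read only registers that no loop assigns and integer arrays that no command
  changes. They keep their values throughout, so the number of passes is known at the start.\<close>

lemma steps_run:
  "bregs c \<inter> lregs c = {} \<Longrightarrow> steps (run c st) = steps st + static_cost st c"
proof (induction c arbitrary: st)
  case (Seq c d)
  have "static_cost (run c st) d = static_cost st d"
    by (rule static_cost_cong) (use Seq.prems in \<open>auto intro!: regs_run\<close>)
  moreover have "bregs c \<inter> lregs c = {}" "bregs d \<inter> lregs d = {}" using Seq.prems by auto
  ultimately show ?case using Seq.IH by simp
next
  case (For x e c)
  let ?n = "1 + icost e" and ?k = "1 + static_cost st c"
  \<comment> \<open>The count alone is not inductive: the static cost of the body stays that of the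
    initial state only because the other registers and the integer arrays do not change, so these
    facts join the invariant.\<close>
  have "steps (run (For x e c) st) = steps st + ?n + ival st e * ?k \<and>
      (\<forall>y. y \<notin> insert x (lregs c) \<longrightarrow> regs (run (For x e c) st) y = regs st y) \<and>
      iarr (run (For x e c) st) = iarr st"
  proof (rule run_For_induct[where P = "\<lambda>v st'. steps st' = steps st + ?n + v * ?k \<and>
      (\<forall>y. y \<notin> insert x (lregs c) \<longrightarrow> regs st' y = regs st y) \<and> iarr st' = iarr st"], goal_cases)
    case (2 v st')
    let ?s = "tick 1 (st' \<lparr> regs := (regs st')(x := v) \<rparr>)"
    have "static_cost ?s c = static_cost st c"
      by (rule static_cost_cong) (use 2 For.prems in \<open>auto simp: disjoint_iff\<close>)
    moreover have "bregs c \<inter> lregs c = {}" using For.prems by auto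
    ultimately have "steps (run c ?s) = steps st' + ?k"
      using For.IH by simp
    then show ?case using 2 by (auto simp: regs_run)
  qed auto
  then show ?case by simp
qed auto

text \<open>
  \<open>S a\<close> is a set of permitted addresses in the array \<open>a\<close>;
  \<open>R x\<close> bounds the possible values of the register \<open>x\<close>; it is \<open>UNIV\<close> outside the loop over \<open>x\<close>.
\<close>

primrec ivals :: "(string \<Rightarrow> nat \<Rightarrow> nat) \<Rightarrow> (string \<Rightarrow> nat set) \<Rightarrow> iexp \<Rightarrow> nat set" where
  "ivals ia R (Reg x) = R x"
| "ivals ia R (ILit n) = {n}"
| "ivals ia R (Lookup a e) = ia a ` ivals ia R e"

primrec cells_ok ::
  "(string \<Rightarrow> nat \<Rightarrow> nat) \<Rightarrow> (string \<Rightarrow> (nat \<times> nat) set) \<Rightarrow> (string \<Rightarrow> nat set) \<Rightarrow> cmd \<Rightarrow> bool" where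
  "cells_ok ia S R (Store a e f p) \<longleftrightarrow> ivals ia R e \<times> ivals ia R f \<subseteq> S a"
| "cells_ok ia S R (Seq c d) \<longleftrightarrow> cells_ok ia S R c \<and> cells_ok ia S R d"
| "cells_ok ia S R (For x e c) \<longleftrightarrow>
     R x = UNIV \<and> cells_ok ia S (R(x := \<Union>n\<in>ivals ia R e. {..<n})) c"

lemma ival_in_ivals: "(\<And>x. regs st x \<in> R x) \<Longrightarrow> ival st e \<in> ivals (iarr st) R e"
  by (induction e) auto

text \<open>Inside a loop the counter is confined to the ranges allowed by the bound. After the loop
  it keeps its last value, and the restriction by \<open>R\<close> holds again because
  \<open>cells_ok\<close> demands \<open>R x = UNIV\<close>.\<close>

lemma cells_run:
  "cells_ok (iarr st) S R c \<Longrightarrow> (\<And>x. regs st x \<in> R x) \<Longrightarrow>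
   cells (run c st) \<subseteq> cells st \<union> Sigma (writes c) S \<and> (\<forall>x. regs (run c st) x \<in> R x)"
proof (induction c arbitrary: st R)
  case (Store a e f p)
  then show ?case using ival_in_ivals[of st R e] ival_in_ivals[of st R f] by auto
next
  case (Seq c d)
  then have "cells (run c st) \<subseteq> cells st \<union> Sigma (writes c) S \<and> (\<forall>x. regs (run c st) x \<in> R x)"
    by (metis cells_ok.simps(2))
  moreover from this have "cells (run d (run c st)) \<subseteq> cells (run c st) \<union> Sigma (writes d) S \<and>
      (\<forall>x. regs (run d (run c st)) x \<in> R x)"
    using Seq by (metis cells_ok.simps(2) iarr_run)
  ultimately show ?case by auto
next
  case (For x e c)
  let ?R = "R(x := \<Union>n\<in>ivals (iarr st) R e. {..<n})"
  have "cells (run (For x e c) st) \<subseteq> cells st \<union> Sigma (writes c) S \<and>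
      (\<forall>y. regs (run (For x e c) st) y \<in> R y) \<and> iarr (run (For x e c) st) = iarr st"
  proof (rule run_For_induct[where P = "\<lambda>v st'. cells st' \<subseteq> cells st \<union> Sigma (writes c) S \<and>
      (\<forall>y. regs st' y \<in> R y) \<and> iarr st' = iarr st"], goal_cases)
    case (2 v st')
    let ?s = "tick 1 (st' \<lparr> regs := (regs st')(x := v) \<rparr>)"
    have v: "v \<in> ?R x" using 2(1) ival_in_ivals[of st R e] For.prems(2) by auto
    have "cells (run c ?s) \<subseteq> cells ?s \<union> Sigma (writes c) S \<and> (\<forall>y. regs (run c ?s) y \<in> ?R y)"
    proof (rule For.IH)
      show "cells_ok (iarr ?s) S ?R c" using For.prems(1) 2 by simp
      show "regs ?s y \<in> ?R y" for y using 2 v by auto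
    qed
    then show ?case using 2 For.prems(1) by (auto split: if_splits)
  qed (use For.prems in auto)
  then show ?case by simp
qed

lemma finite_writes [simp]: "finite (writes c)"
  by (induction c) auto

text \<open>\<open>w\<close> is the product of the numbers of passes of the enclosing loops.\<close>

primrec loops_within :: "mstate \<Rightarrow> nat \<Rightarrow> nat \<Rightarrow> cmd \<Rightarrow> bool" where
  "loops_within st w M (Store a e f p) \<longleftrightarrow> w \<le> M"
| "loops_within st w M (Seq c d) \<longleftrightarrow> loops_within st w M c \<and> loops_within st w M d"
| "loops_within st w M (For x e c) \<longleftrightarrow> w \<le> M \<and> loops_within st (w * ival st e) M c"

text \<open>This number depends on the program text alone and becomes the constant of the time
  bound. The 2 at a loop is one unit for the header and one for each pass.\<close>

primrec cost_const :: "cmd \<Rightarrow> nat" where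
  "cost_const (Store a e f p) = 1 + icost e + icost f + rcost p"
| "cost_const (Seq c d) = cost_const c + cost_const d"
| "cost_const (For x e c) = 2 + icost e + cost_const c"

lemma loops_within_le: "loops_within st w M c \<Longrightarrow> w \<le> M"
  by (induction c) auto

text \<open>A node executed \<open>w\<close> times costs \<open>w\<close> times its own charge, and
  every such product of pass numbers is at most \<open>M\<close>. Loop headers are charged with the
  outer product, since a loop without passes still evaluates its bound.\<close>

lemma static_cost_le: "loops_within st w M c \<Longrightarrow> w * static_cost st c \<le> cost_const c * M"
proof (induction c arbitrary: w)
  case (Store a e f p)
  then show ?case
    unfolding static_cost.simps cost_const.simps loops_within.simps
    by (subst mult.commute) (rule mult_le_mono2)
next
  case (Seq c d)
  then have "w * static_cost st c \<le> cost_const c * M" "w * static_cost st d \<le> cost_const d * M"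
    by auto
  then show ?case by (simp add: algebra_simps)
next
  case (For x e c)
  let ?n = "ival st e"
  have "w * (1 + icost e) \<le> M * (1 + icost e)" using For.prems by (intro mult_le_mono1) simp
  moreover have "w * ?n \<le> M" using For.prems loops_within_le[of st "w * ?n"] by auto
  moreover have "w * ?n * static_cost st c \<le> cost_const c * M" using For by auto
  ultimately show ?case by (simp add: algebra_simps)
qed

section \<open>Accumulation loops\<close>

definition zero_block :: "string \<Rightarrow> iexp \<Rightarrow> iexp \<Rightarrow> cmd" where
  "zero_block a n l = For ''i'' n (For ''j'' l (Store a (Reg ''i'') (Reg ''j'') (RLit 0)))"

definition accumulate ::
  "(string \<times> iexp) list \<Rightarrow> string \<Rightarrow> iexp \<Rightarrow> iexp \<Rightarrow> rexp \<Rightarrow> cmd" where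
  "accumulate xs a e f p = foldr (\<lambda>(x, b). For x b) xs (Store a e f (Add (Cell a e f) p))"

text \<open>The total increment that the loop nest makes at address \<open>(i, j)\<close>, expressed
  in the state before the nest with only the counters replaced. As the target address may depend on
  the counters, this covers entrywise updates as well as scattering along the sampled
  positions.\<close>

primrec acc_value ::
  "(string \<times> iexp) list \<Rightarrow> iexp \<Rightarrow> iexp \<Rightarrow> rexp \<Rightarrow> mstate \<Rightarrow> nat \<Rightarrow> nat \<Rightarrow> real" where
  "acc_value [] e f p st i j = (if ival st e = i \<and> ival st f = j then rval st p else 0)"
| "acc_value (xb # xs) e f p st i j =
     (\<Sum>v<ival st (snd xb). acc_value xs e f p (st \<lparr> regs := (regs st)(fst xb := v) \<rparr>) i j)"

lemma accumulate_simps: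
  "accumulate [] a e f p = Store a e f (Add (Cell a e f) p)"
  "accumulate ((x, b) # xs) a e f p = For x b (accumulate xs a e f p)"
  by (auto simp: accumulate_def)

lemma writes_accumulate [simp]: "writes (accumulate xs a e f p) = {a}"
  by (induction xs) (simp_all add: accumulate_def case_prod_beta)

lemma lregs_accumulate [simp]: "lregs (accumulate xs a e f p) = fst ` set xs"
  by (induction xs) (simp_all add: accumulate_def case_prod_beta)

lemma acc_value_cong:
  assumes "a \<notin> rreads p" "(\<Union>b\<in>snd ` set xs. iregs b) \<inter> fst ` set xs = {}"
    and "\<And>x. x \<notin> fst ` set xs \<Longrightarrow> regs st x = regs st' x"
    and "iarr st = iarr st'" "\<And>b. b \<noteq> a \<Longrightarrow> rarr st b = rarr st' b"
  shows "acc_value xs e f p st i j = acc_value xs e f p st' i j"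
  using assms(2-)
proof (induction xs arbitrary: st st')
  case Nil
  then have "ival st e = ival st' e" "ival st f = ival st' f" "rval st p = rval st' p"
    using assms(1) by (auto intro!: ival_cong rval_cong) metis
  then show ?case by simp
next
  case (Cons xb xs)
  have "ival st (snd xb) = ival st' (snd xb)"
    using Cons.prems by (intro ival_cong) (auto simp: disjoint_iff)
  moreover have "acc_value xs e f p (st \<lparr> regs := (regs st)(fst xb := v) \<rparr>) i j =
      acc_value xs e f p (st' \<lparr> regs := (regs st')(fst xb := v) \<rparr>) i j" for v
    by (rule Cons.IH) (use Cons.prems in auto)
  ultimately show ?case by simp
qed

text \<open>The summand does not read the target array, so earlier additions do not influence later
  ones, and no bound mentions a counter of the nest, so the nest runs over a full box. Hence the
  loops compute a plain sum.\<close>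

lemma rarr_accumulate:
  assumes "a \<notin> rreads p" "(\<Union>b\<in>snd ` set xs. iregs b) \<inter> fst ` set xs = {}"
  shows "rarr (run (accumulate xs a e f p) st) a i j = rarr st a i j + acc_value xs e f p st i j"
  using assms(2)
proof (induction xs arbitrary: st)
  case Nil
  then show ?case by (simp add: accumulate_simps)
next
  case (Cons xb xs)
  obtain x b where xb: "xb = (x, b)" by fastforce
  let ?c = "accumulate xs a e f p"
  let ?g = "\<lambda>v. acc_value xs e f p (st \<lparr> regs := (regs st)(x := v) \<rparr>) i j"
  let ?P = "\<lambda>v st'. rarr st' a i j = rarr st a i j + (\<Sum>w<v. ?g w) \<and>
      (\<forall>y. y \<notin> insert x (fst ` set xs) \<longrightarrow> regs st' y = regs st y) \<and> iarr st' = iarr st \<and>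
      (\<forall>b. b \<noteq> a \<longrightarrow> rarr st' b = rarr st b)"
  have "?P (ival st b) (run (For x b ?c) st)"
  proof (rule run_For_induct[where P = ?P], goal_cases)
    case (2 v st')
    let ?s = "tick 1 (st' \<lparr> regs := (regs st')(x := v) \<rparr>)"
    have "acc_value xs e f p ?s i j = ?g v"
      by (rule acc_value_cong[OF assms(1)]) (use Cons.prems 2 in auto)
    moreover have "rarr (run ?c ?s) a i j = rarr ?s a i j + acc_value xs e f p ?s i j"
      by (rule Cons.IH) (use Cons.prems in auto)
    ultimately show ?case using 2 by (auto simp: regs_run rarr_run)
  qed auto
  then show ?case by (simp add: xb accumulate_simps)
qed

text \<open>The inner bound is evaluated again after \<open>i\<close> and \<open>j\<close> have been
  assigned, the outer one only before; hence the restriction on \<open>l\<close>.\<close>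

lemma rarr_zero_block:
  assumes "''i'' \<notin> iregs l" "''j'' \<notin> iregs l"
  shows "rarr (run (zero_block a n l) st) a i j =
    (if i < ival st n \<and> j < ival st l then 0 else rarr st a i j)"
proof -
  let ?c = "Store a (Reg ''i'') (Reg ''j'') (RLit 0)"
  have inner: "rarr (run (For ''j'' l ?c) st') a i j =
      (if i = regs st' ''i'' \<and> j < ival st' l then 0 else rarr st' a i j) \<and>
      regs (run (For ''j'' l ?c) st') ''i'' = regs st' ''i''" for st'
    by (rule run_For_induct[where P = "\<lambda>v s. rarr s a i j =
        (if i = regs st' ''i'' \<and> j < v then 0 else rarr st' a i j) \<and> regs s ''i'' = regs st' ''i''"])
       auto
  let ?P = "\<lambda>v s. rarr s a i j = (if i < v \<and> j < ival st l then 0 else rarr st a i j) \<and>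
      (\<forall>y. y \<notin> {''i'', ''j''} \<longrightarrow> regs s y = regs st y) \<and> iarr s = iarr st"
  have "?P (ival st n) (run (For ''i'' n (For ''j'' l ?c)) st)"
  proof (rule run_For_induct[where P = ?P], goal_cases)
    case (2 v st')
    let ?s = "tick 1 (st' \<lparr> regs := (regs st')(''i'' := v) \<rparr>)"
    have "ival ?s l = ival st l"
      using 2 assms by (intro ival_cong) auto
    moreover have "regs (run (For ''j'' l ?c) ?s) y = regs st y" if "y \<notin> {''i'', ''j''}" for y
      using that 2 regs_run[of y "For ''j'' l ?c" ?s] by simp
    ultimately show ?case
      using 2 inner[of ?s] by (simp add: less_Suc_eq del: run.simps)
  qed auto
  then show ?thesis by (simp add: zero_block_def)
qed

section \<open>Coordinates with respect to the singular vectors\<close>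

lemma orthogonal_matrix_cols:
  assumes "orthogonal_matrix n Q" "i < n" "j < n"
  shows "(\<Sum>a<n. Q $$ (a,i) * Q $$ (a,j)) = (if i = j then 1 else 0)"
proof -
  have Q: "Q \<in> carrier_mat n n" "Q\<^sup>T * Q = 1\<^sub>m n" using assms by (auto simp: orthogonal_matrix_def)
  have "(Q\<^sup>T * Q) $$ (i,j) = (\<Sum>a<n. Q $$ (a,i) * Q $$ (a,j))"
    using Q(1) assms(2,3) by (auto simp: scalar_prod_def atLeast0LessThan intro!: sum.cong)
  then show ?thesis using Q assms(2,3) by simp
qed

lemma orthogonal_matrix_rows:
  assumes "orthogonal_matrix n Q" "i < n" "j < n"
  shows "(\<Sum>a<n. Q $$ (i,a) * Q $$ (j,a)) = (if i = j then 1 else 0)"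
proof -
  have Q: "Q \<in> carrier_mat n n" "Q\<^sup>T * Q = 1\<^sub>m n" using assms by (auto simp: orthogonal_matrix_def)
  then have "Q * Q\<^sup>T = 1\<^sub>m n" using mat_mult_left_right_inverse[of "Q\<^sup>T" n Q] by simp
  moreover have "(Q * Q\<^sup>T) $$ (i,j) = (\<Sum>a<n. Q $$ (i,a) * Q $$ (j,a))"
    using Q(1) assms(2,3) by (auto simp: scalar_prod_def atLeast0LessThan intro!: sum.cong)
  ultimately show ?thesis using Q assms(2,3) by simp
qed

lemma sum_delta_mult:
  fixes f :: "nat \<Rightarrow> real"
  assumes "\<And>i. i < n \<Longrightarrow> c i = (if i = k then 1 else 0)" "k < n"
  shows "(\<Sum>i<n. f i * c i) = f k"
proof -
  have "(\<Sum>i<n. f i * c i) = (\<Sum>i<n. if i = k then f i else 0)"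
    using assms(1) by (intro sum.cong) auto
  then show ?thesis using assms(2) by simp
qed

text \<open>The orthonormal family is a two-place function and may have fewer members than the space
  has dimensions. One statement thus serves columns, rows (with the arguments of \<open>Q\<close>
  exchanged) and the leading \<open>r\<close> columns.\<close>

lemma sum_orthonormal_left:
  fixes f :: "nat \<Rightarrow> real"
  assumes "\<And>j. j < n \<Longrightarrow> (\<Sum>a<m. Q a i * Q a j) = (if j = i then 1 else 0)" "i < n"
  shows "(\<Sum>a<m. Q a i * (\<Sum>j<n. f j * Q a j)) = f i"
proof -
  have "(\<Sum>a<m. Q a i * (\<Sum>j<n. f j * Q a j)) = (\<Sum>j<n. f j * (\<Sum>a<m. Q a i * Q a j))"
    by (simp add: sum_distrib_left sum.swap[of _ "{..<m}"] mult_ac)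
  also have "\<dots> = f i" using assms by (intro sum_delta_mult) auto
  finally show ?thesis .
qed

locale svd_bases =
  fixes d1 d2 r :: nat and U V :: "real mat"
  assumes U: "orthogonal_matrix d1 U" and V: "orthogonal_matrix d2 V"
    and r_d1: "r \<le> d1" and r_d2: "r \<le> d2"
begin

abbreviation "coord \<equiv> tangent_adj U V"
abbreviation "I \<equiv> tangent_idx d1 d2 r"

definition expand :: "(nat \<times> nat \<Rightarrow> real) \<Rightarrow> nat \<Rightarrow> nat \<Rightarrow> real" where
  "expand c a b = (\<Sum>i<d1. \<Sum>j<d2. c (i,j) * (U $$ (a,i) * V $$ (b,j)))"

lemma dims [simp]: "dim_row U = d1" "dim_col U = d1" "dim_row V = d2" "dim_col V = d2"
  using U V by (auto simp: orthogonal_matrix_def)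

lemmas U_cols = orthogonal_matrix_cols[OF U] and V_cols = orthogonal_matrix_cols[OF V]
  and U_rows = orthogonal_matrix_rows[OF U] and V_rows = orthogonal_matrix_rows[OF V]

lemma finite_I [simp]: "finite I"
  by (rule finite_subset[of _ "{..<d1} \<times> {..<d2}"]) (auto simp: tangent_idx_def)

lemma coord_alt: "coord Z (i,j) = (\<Sum>a<d1. U $$ (a,i) * (\<Sum>b<d2. V $$ (b,j) * Z $$ (a,b)))"
  by (simp add: tangent_adj_def sum_distrib_left mult_ac)

lemma coord_alt2: "coord Z (i,j) = (\<Sum>b<d2. V $$ (b,j) * (\<Sum>a<d1. U $$ (a,i) * Z $$ (a,b)))"
  unfolding tangent_adj_def by (subst sum.swap) (simp add: sum_distrib_left mult_ac)

lemma expand_alt: "expand c a b = (\<Sum>i<d1. (\<Sum>j<d2. c (i,j) * V $$ (b,j)) * U $$ (a,i))"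
  by (simp add: expand_def sum_distrib_left sum_distrib_right mult_ac)

lemma expand_alt2: "expand c a b = (\<Sum>j<d2. (\<Sum>i<d1. c (i,j) * U $$ (a,i)) * V $$ (b,j))"
  unfolding expand_def by (subst sum.swap) (simp add: sum_distrib_left sum_distrib_right mult_ac)

lemma coord_expand:
  assumes "\<And>a b. a < d1 \<Longrightarrow> b < d2 \<Longrightarrow> Z $$ (a,b) = expand c a b" "i < d1" "j < d2"
  shows "coord Z (i,j) = c (i,j)"
proof -
  have "(\<Sum>b<d2. V $$ (b,j) * Z $$ (a,b)) = (\<Sum>i<d1. c (i,j) * U $$ (a,i))" if "a < d1" for a
  proof -
    have "(\<Sum>b<d2. V $$ (b,j) * Z $$ (a,b)) =
        (\<Sum>b<d2. V $$ (b,j) * (\<Sum>l<d2. (\<Sum>i<d1. c (i,l) * U $$ (a,i)) * V $$ (b,l)))"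
      using assms(1) that by (simp add: expand_alt2)
    also have "\<dots> = (\<Sum>i<d1. c (i,j) * U $$ (a,i))"
      by (rule sum_orthonormal_left) (use V_cols assms(3) in auto)
    finally show ?thesis .
  qed
  then have "coord Z (i,j) = (\<Sum>a<d1. U $$ (a,i) * (\<Sum>l<d1. c (l,j) * U $$ (a,l)))"
    by (simp add: coord_alt)
  also have "\<dots> = c (i,j)"
    by (rule sum_orthonormal_left) (use U_cols assms(2) in auto)
  finally show ?thesis .
qed

text \<open>Undoing the change of basis on the right only leaves \<open>u_i^T Z\<close>. A sum over
  all right vectors thereby becomes an expression in \<open>U\<close> and \<open>Z\<close>.\<close>

lemma sum_V_coord:
  assumes "b < d2"
  shows "(\<Sum>j<d2. coord Z (i,j) * V $$ (b,j)) = (\<Sum>a<d1. U $$ (a,i) * Z $$ (a,b))"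
proof -
  have "(\<Sum>j<d2. coord Z (i,j) * V $$ (b,j)) =
      (\<Sum>j<d2. V $$ (b,j) * (\<Sum>c<d2. (\<Sum>a<d1. U $$ (a,i) * Z $$ (a,c)) * V $$ (c,j)))"
    by (simp add: coord_alt2 mult_ac)
  also have "\<dots> = (\<Sum>a<d1. U $$ (a,i) * Z $$ (a,b))"
    by (rule sum_orthonormal_left[where Q = "\<lambda>j b. V $$ (b,j)"]) (use V_rows assms in auto)
  finally show ?thesis .
qed

lemma sum_U_coord:
  assumes "a < d1"
  shows "(\<Sum>i<d1. coord Z (i,j) * U $$ (a,i)) = (\<Sum>b<d2. V $$ (b,j) * Z $$ (a,b))"
proof -
  have "(\<Sum>i<d1. coord Z (i,j) * U $$ (a,i)) =
      (\<Sum>i<d1. U $$ (a,i) * (\<Sum>c<d1. (\<Sum>b<d2. V $$ (b,j) * Z $$ (c,b)) * U $$ (c,i)))"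
    by (simp add: coord_alt mult_ac)
  also have "\<dots> = (\<Sum>b<d2. V $$ (b,j) * Z $$ (a,b))"
    by (rule sum_orthonormal_left[where Q = "\<lambda>j b. U $$ (b,j)"]) (use U_rows assms in auto)
  finally show ?thesis .
qed

lemma expand_coord:
  assumes "a < d1" "b < d2"
  shows "expand (coord Z) a b = Z $$ (a,b)"
proof -
  have "expand (coord Z) a b = (\<Sum>i<d1. U $$ (a,i) * (\<Sum>c<d1. Z $$ (c,b) * U $$ (c,i)))"
    using assms by (simp add: expand_alt sum_V_coord) (simp add: mult_ac)
  also have "\<dots> = Z $$ (a,b)"
    by (rule sum_orthonormal_left[where Q = "\<lambda>j b. U $$ (b,j)"]) (use U_rows assms in auto)
  finally show ?thesis .
qed

lemma mat_eq_of_coord_eq: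
  assumes "Z \<in> carrier_mat d1 d2" "Z' \<in> carrier_mat d1 d2"
    and "\<And>i j. i < d1 \<Longrightarrow> j < d2 \<Longrightarrow> coord Z (i,j) = coord Z' (i,j)"
  shows "Z = Z'"
proof (rule eq_matI)
  fix a b assume "a < dim_row Z'" "b < dim_col Z'"
  then have "a < d1" "b < d2" using assms by auto
  then have "Z $$ (a,b) = expand (coord Z) a b" "Z' $$ (a,b) = expand (coord Z') a b"
    by (simp_all add: expand_coord)
  moreover have "expand (coord Z) a b = expand (coord Z') a b"
    using assms(3) by (simp add: expand_def)
  ultimately show "Z $$ (a,b) = Z' $$ (a,b)" by simp
qed (use assms in auto)

lemma coord_lincomb:
  assumes "Z \<in> carrier_mat d1 d2" "Z' \<in> carrier_mat d1 d2"
  shows "coord (Z + x \<cdot>\<^sub>m Z') ij = coord Z ij + x * coord Z' ij"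
  using assms
  by (cases ij) (simp add: tangent_adj_def sum.distrib[symmetric] sum_distrib_left algebra_simps)

text \<open>Only the coordinates of \<open>Z'\<close> are unfolded. After reordering, the inner
  double sum is \<open>expand (coord Z)\<close>, which is \<open>Z\<close> again.\<close>

lemma Parseval:
  "(\<Sum>a<d1. \<Sum>b<d2. Z $$ (a,b) * Z' $$ (a,b)) = (\<Sum>i<d1. \<Sum>j<d2. coord Z (i,j) * coord Z' (i,j))"
proof -
  have "(\<Sum>i<d1. \<Sum>j<d2. coord Z (i,j) * coord Z' (i,j)) =
      (\<Sum>i<d1. \<Sum>j<d2. \<Sum>a<d1. \<Sum>b<d2. coord Z (i,j) * (U $$ (a,i) * V $$ (b,j)) * Z' $$ (a,b))"
    by (simp add: tangent_adj_def[of U V Z'] sum_distrib_left mult_ac)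
  also have "\<dots> = (\<Sum>i<d1. \<Sum>a<d1. \<Sum>j<d2. \<Sum>b<d2. coord Z (i,j) * (U $$ (a,i) * V $$ (b,j)) * Z' $$ (a,b))"
    by (intro sum.cong refl sum.swap)
  also have "\<dots> = (\<Sum>i<d1. \<Sum>a<d1. \<Sum>b<d2. \<Sum>j<d2. coord Z (i,j) * (U $$ (a,i) * V $$ (b,j)) * Z' $$ (a,b))"
    by (intro sum.cong refl sum.swap)
  also have "\<dots> = (\<Sum>a<d1. \<Sum>i<d1. \<Sum>b<d2. \<Sum>j<d2. coord Z (i,j) * (U $$ (a,i) * V $$ (b,j)) * Z' $$ (a,b))"
    by (rule sum.swap)
  also have "\<dots> = (\<Sum>a<d1. \<Sum>b<d2. \<Sum>i<d1. \<Sum>j<d2. coord Z (i,j) * (U $$ (a,i) * V $$ (b,j)) * Z' $$ (a,b))"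
    by (intro sum.cong refl sum.swap)
  also have "\<dots> = (\<Sum>a<d1. \<Sum>b<d2. expand (coord Z) a b * Z' $$ (a,b))"
    by (simp add: expand_def sum_distrib_right)
  also have "\<dots> = (\<Sum>a<d1. \<Sum>b<d2. Z $$ (a,b) * Z' $$ (a,b))"
    by (simp add: expand_coord)
  finally show ?thesis ..
qed

section \<open>The tangent space\<close>

lemma tangent_map_carrier [simp]: "tangent_map d1 d2 r U V g \<in> carrier_mat d1 d2"
  by (simp add: tangent_map_def)

lemma sum_I:
  "(\<Sum>ij\<in>I. f ij) = (\<Sum>i<d1. \<Sum>j<d2. if i < r \<or> j < r then f (i,j) else (0::real))"
proof -
  have "(\<Sum>ij\<in>I. f ij) = (\<Sum>ij\<in>{..<d1} \<times> {..<d2}. if fst ij < r \<or> snd ij < r then f ij else 0)"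
    by (rule sum.mono_neutral_cong_left) (auto simp: tangent_idx_def)
  then show ?thesis by (auto simp: sum.cartesian_product intro!: sum.cong)
qed

lemma tangent_map_expand:
  assumes "a < d1" "b < d2"
  shows "tangent_map d1 d2 r U V g $$ (a,b) = expand (\<lambda>ij. if ij \<in> I then g ij else 0) a b"
  using assms
  by (simp add: tangent_map_def expand_def case_prod_beta sum_I)
    (auto simp: tangent_idx_def intro!: sum.cong)

lemma coord_tangent_map:
  assumes "i < d1" "j < d2"
  shows "coord (tangent_map d1 d2 r U V g) (i,j) = (if (i,j) \<in> I then g (i,j) else 0)"
  by (rule coord_expand[OF tangent_map_expand assms])

text \<open>
  An element of \<open>T\<close> with coordinates \<open>g\<close> is stored as the core \<open>g (i,j)\<close> for \<open>i, j < r\<close> together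
  with the factors \<open>right_factor g\<close> and \<open>left_factor g\<close>, whose columns are orthogonal to the leading
  right and left singular vectors.  This only involves the leading singular vectors.
\<close>

definition right_factor :: "(nat \<times> nat \<Rightarrow> real) \<Rightarrow> nat \<Rightarrow> nat \<Rightarrow> real" where
  "right_factor g b i = (\<Sum>j\<in>{r..<d2}. g (i,j) * V $$ (b,j))"

definition left_factor :: "(nat \<times> nat \<Rightarrow> real) \<Rightarrow> nat \<Rightarrow> nat \<Rightarrow> real" where
  "left_factor g a j = (\<Sum>i\<in>{r..<d1}. g (i,j) * U $$ (a,i))"

text \<open>With \<open>G\<close> the core and \<open>A\<close> the right factor this is
  \<open>E = A + V_r G^T\<close>, so that \<open>U_r G V_r^T + U_r A^T = U_r E^T\<close>. It
  supplies the factor \<open>M1\<close> of the representation.\<close>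

definition ext_core :: "(nat \<times> nat \<Rightarrow> real) \<Rightarrow> nat \<Rightarrow> nat \<Rightarrow> real" where
  "ext_core \<gamma> b t = right_factor \<gamma> b t + (\<Sum>j<r. \<gamma> (t,j) * V $$ (b,j))"

lemma sum_split_r:
  fixes f :: "nat \<Rightarrow> real"
  assumes "r \<le> n" shows "(\<Sum>i<n. f i) = (\<Sum>i<r. f i) + (\<Sum>i\<in>{r..<n}. f i)"
proof -
  have "{..<n} = {..<r} \<union> {r..<n}" using assms by auto
  then show ?thesis by (simp add: sum.union_disjoint disjoint_iff)
qed

text \<open>In \<open>I\<close> a leading \<open>i\<close> allows every \<open>j\<close>, a trailing
  \<open>i\<close> only a leading \<open>j\<close>. The first kind gives full rows of coordinates
  and thus \<open>ext_core\<close>, the second gives the left factor.\<close>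

lemma tangent_map_factors:
  assumes "a < d1" "b < d2"
  shows "tangent_map d1 d2 r U V g $$ (a,b) =
    (\<Sum>t<r. U $$ (a,t) * ext_core g b t) + (\<Sum>t<r. left_factor g a t * V $$ (b,t))"
proof -
  have 1: "(\<Sum>j<d2. (if (i,j) \<in> I then g (i,j) else 0) * V $$ (b,j)) =
      ext_core g b i" if "i < r" for i
    using that r_d1 r_d2 by (simp add: sum_split_r[OF r_d2] ext_core_def right_factor_def tangent_idx_def)
  have 2: "(\<Sum>j<d2. (if (i,j) \<in> I then g (i,j) else 0) * V $$ (b,j)) =
      (\<Sum>j<r. g (i,j) * V $$ (b,j))" if "r \<le> i" "i < d1" for i
    using that r_d1 r_d2 by (simp add: sum_split_r[OF r_d2] tangent_idx_def)
  have "tangent_map d1 d2 r U V g $$ (a,b) =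
      (\<Sum>t<r. U $$ (a,t) * ext_core g b t) +
      (\<Sum>i\<in>{r..<d1}. (\<Sum>j<r. g (i,j) * V $$ (b,j)) * U $$ (a,i))"
    using assms by (simp add: tangent_map_expand expand_alt sum_split_r[OF r_d1] 1 2)
      (simp add: mult_ac)
  also have "(\<Sum>i\<in>{r..<d1}. (\<Sum>j<r. g (i,j) * V $$ (b,j)) * U $$ (a,i)) =
      (\<Sum>t<r. left_factor g a t * V $$ (b,t))"
    unfolding sum_distrib_right left_factor_def by (subst sum.swap) (simp add: mult_ac)
  finally show ?thesis .
qed

lemma tangent_map_product:
  "tangent_map d1 d2 r U V g =
     first_cols r U * (mat d2 r (\<lambda>(b,t). ext_core g b t))\<^sup>T +
     mat d1 r (\<lambda>(a,t). left_factor g a t) * (first_cols r V)\<^sup>T"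
  by (rule eq_matI)
    (auto simp: tangent_map_factors first_cols_def scalar_prod_def atLeast0LessThan
      carrier_matD[OF tangent_map_carrier])

text \<open>This is \<open>(Id - V_r V_r^T) Z^T u_i\<close>: the trailing part is the total minus
  the leading part, and \<open>sum_V_coord\<close> knows the total. For \<open>i < r\<close> the
  right-hand side involves leading vectors only, although the factor is defined by the trailing
  ones.\<close>

lemma right_factor_coord:
  assumes "b < d2"
  shows "right_factor (coord Z) b i =
    (\<Sum>a<d1. U $$ (a,i) * Z $$ (a,b)) - (\<Sum>j<r. coord Z (i,j) * V $$ (b,j))"
  using sum_V_coord[OF assms, of Z i] by (simp add: right_factor_def sum_split_r[OF r_d2])

lemma left_factor_coord:
  assumes "a < d1"
  shows "left_factor (coord Z) a j =
    (\<Sum>b<d2. V $$ (b,j) * Z $$ (a,b)) - (\<Sum>i<r. coord Z (i,j) * U $$ (a,i))"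
  using sum_U_coord[OF assms, of Z j] by (simp add: left_factor_def sum_split_r[OF r_d1])

lemma inner_orthonormal:
  fixes f g :: "nat \<Rightarrow> real"
  assumes "\<And>i j. i \<in> J \<Longrightarrow> j \<in> J \<Longrightarrow> (\<Sum>a<n. Q a i * Q a j) = (if i = j then 1 else 0)"
    and "finite J"
  shows "(\<Sum>a<n. (\<Sum>i\<in>J. f i * Q a i) * (\<Sum>j\<in>J. g j * Q a j)) = (\<Sum>i\<in>J. f i * g i)"
proof -
  have "(\<Sum>a<n. (\<Sum>i\<in>J. f i * Q a i) * (\<Sum>j\<in>J. g j * Q a j)) =
      (\<Sum>a<n. \<Sum>i\<in>J. \<Sum>j\<in>J. f i * g j * (Q a i * Q a j))"
    by (simp add: sum_product mult_ac)
  also have "\<dots> = (\<Sum>i\<in>J. \<Sum>a<n. \<Sum>j\<in>J. f i * g j * (Q a i * Q a j))" by (rule sum.swap)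
  also have "\<dots> = (\<Sum>i\<in>J. \<Sum>j\<in>J. \<Sum>a<n. f i * g j * (Q a i * Q a j))"
    by (intro sum.cong refl sum.swap)
  also have "\<dots> = (\<Sum>i\<in>J. \<Sum>j\<in>J. if i = j then f i * g j else 0)"
    by (intro sum.cong refl) (simp add: sum_distrib_left[symmetric] assms(1))
  also have "\<dots> = (\<Sum>i\<in>J. f i * g i)" using assms(2) by simp
  finally show ?thesis .
qed

text \<open>The trailing vectors are orthonormal and cancel in the inner products of the factors. By
  this isometry the stored arrays yield the exact conjugate gradient coefficients.\<close>

lemma coord_inner_factors:
  "coord_inner I g h = (\<Sum>i<r. \<Sum>j<r. g (i,j) * h (i,j)) +
    (\<Sum>b<d2. \<Sum>i<r. right_factor g b i * right_factor h b i) +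
    (\<Sum>a<d1. \<Sum>j<r. left_factor g a j * left_factor h a j)"
proof -
  have R: "(\<Sum>b<d2. \<Sum>i<r. right_factor g b i * right_factor h b i) =
      (\<Sum>i<r. \<Sum>j\<in>{r..<d2}. g (i,j) * h (i,j))"
    unfolding right_factor_def
    by (subst sum.swap, intro sum.cong refl inner_orthonormal) (auto simp: V_cols)
  have L: "(\<Sum>a<d1. \<Sum>j<r. left_factor g a j * left_factor h a j) =
      (\<Sum>j<r. \<Sum>i\<in>{r..<d1}. g (i,j) * h (i,j))"
    unfolding left_factor_def
    by (subst sum.swap, intro sum.cong refl inner_orthonormal) (auto simp: U_cols)
  have "coord_inner I g h =
      (\<Sum>i<r. \<Sum>j<r. g (i,j) * h (i,j)) + (\<Sum>i<r. \<Sum>j\<in>{r..<d2}. g (i,j) * h (i,j)) +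
      (\<Sum>i\<in>{r..<d1}. \<Sum>j<r. g (i,j) * h (i,j))"
    unfolding coord_inner_def sum_I sum_split_r[OF r_d1] sum_split_r[OF r_d2]
    by (simp add: sum.distrib)
  then show ?thesis unfolding R L by (subst (3) sum.swap) simp
qed

lemma factors_lincomb:
  "right_factor (\<lambda>ij. g ij + x * h ij) b i = right_factor g b i + x * right_factor h b i"
  "left_factor (\<lambda>ij. g ij + x * h ij) a j = left_factor g a j + x * left_factor h a j"
  by (simp_all add: right_factor_def left_factor_def sum.distrib sum_distrib_left algebra_simps)

lemma factors_cong:
  assumes "\<And>ij. ij \<in> I \<Longrightarrow> g ij = h ij"
  shows "i < r \<Longrightarrow> right_factor g b i = right_factor h b i"
    and "j < r \<Longrightarrow> left_factor g a j = left_factor h a j"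
    and "i < r \<Longrightarrow> j < r \<Longrightarrow> g (i,j) = h (i,j)"
  using assms r_d1 r_d2 by (auto simp: right_factor_def left_factor_def tangent_idx_def intro!: sum.cong)

end

section \<open>The weighted least squares problem\<close>

lemma sample_adj_carrier [simp]: "sample_adj d1 d2 \<Omega> w \<in> carrier_mat d1 d2"
  by (simp add: sample_adj_def)

text \<open>Distinctness leaves a single summand; values at a repeated position would add
  up.\<close>

lemma sample_adj_nth:
  assumes "distinct \<Omega>" "l < length \<Omega>" "\<Omega> ! l = (a, b)" "a < d1" "b < d2"
  shows "sample_adj d1 d2 \<Omega> w $$ (a,b) = w $ l"
proof -
  have "(\<Sum>k<length \<Omega>. if \<Omega> ! k = (a,b) then w $ k else 0) =
      (\<Sum>k<length \<Omega>. if k = l then w $ k else 0)"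
    using assms(1-3) nth_eq_iff_index_eq[OF assms(1) _ assms(2)] by (intro sum.cong) auto
  then show ?thesis using assms by (simp add: sample_adj_def)
qed

lemma sample_adj_outside:
  assumes "(a,b) \<notin> set \<Omega>" "a < d1" "b < d2"
  shows "sample_adj d1 d2 \<Omega> w $$ (a,b) = 0"
  using assms by (auto simp: sample_adj_def in_set_conv_nth intro!: sum.neutral)

lemma sample_sample_adj:
  assumes "distinct \<Omega>" "set \<Omega> \<subseteq> {..<d1} \<times> {..<d2}" "w \<in> carrier_vec (length \<Omega>)"
  shows "sample \<Omega> (sample_adj d1 d2 \<Omega> w) = w"
proof (rule eq_vecI)
  fix l assume "l < dim_vec w"
  moreover then have "\<Omega> ! l \<in> {..<d1} \<times> {..<d2}" using assms(2,3) nth_mem by fastforce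
  ultimately show "sample \<Omega> (sample_adj d1 d2 \<Omega> w) $ l = w $ l"
    using assms by (cases "\<Omega> ! l") (auto simp: sample_def sample_adj_nth)
qed (use assms in \<open>auto simp: sample_def\<close>)

section \<open>The weighted quadratic form and its constrained minimizer\<close>

locale weighted_bases = svd_bases +
  fixes e :: real and s :: "nat \<Rightarrow> real"
  assumes e_pos: "0 < e" and s_low: "\<And>i. r \<le> i \<Longrightarrow> s i \<le> e" and s_high: "\<And>i. i < r \<Longrightarrow> e < s i"
begin

abbreviation "W \<equiv> weight_op d1 d2 e U s V"
abbreviation "H \<equiv> weight e s"

lemma H_pos: "0 < H i j"
  using e_pos by (auto simp: weight_def intro!: mult_pos_pos)

lemma inverse_H: "inverse (H i j) = max (s i) e * max (s j) e"
  by (simp add: weight_def)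

lemma max_s: "max (s i) e = (if i < r then s i else e)"
  using s_low[of i] s_high[of i] by auto

lemma W_carrier [simp]: "W Z \<in> carrier_mat d1 d2"
  by (simp add: weight_op_def carrier_matI)

lemma W_expand:
  assumes "Z \<in> carrier_mat d1 d2" "a < d1" "b < d2"
  shows "W Z $$ (a,b) = expand (\<lambda>(i,j). H i j * coord Z (i,j)) a b"
proof -
  have "(U\<^sup>T * Z * V) $$ (i,j) = coord Z (i,j)" if "i < d1" "j < d2" for i j
    using assms that
    by (simp add: coord_alt2 scalar_prod_def atLeast0LessThan mult_ac)
  then show ?thesis
    using assms
    by (simp add: weight_op_def expand_alt2 scalar_prod_def atLeast0LessThan mult_ac)
qed

lemma coord_W:
  assumes "Z \<in> carrier_mat d1 d2" "i < d1" "j < d2"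
  shows "coord (W Z) (i,j) = H i j * coord Z (i,j)"
  using coord_expand[OF W_expand, OF assms(1) _ _ assms(2,3)] by simp

text \<open>The bilinear form \<open><Z, W Z'>\<close> in the coordinates that diagonalize
  \<open>W\<close>, where symmetry and positivity are visible.\<close>

definition wform :: "real mat \<Rightarrow> real mat \<Rightarrow> real" where
  "wform Z Z' = (\<Sum>i<d1. \<Sum>j<d2. H i j * (coord Z (i,j) * coord Z' (i,j)))"

lemma wform_W:
  assumes "Z' \<in> carrier_mat d1 d2"
  shows "wform Z Z' = (\<Sum>a<d1. \<Sum>b<d2. Z $$ (a,b) * W Z' $$ (a,b))"
  using assms by (simp add: Parseval wform_def coord_W mult_ac)

lemma frob_inner_W:
  assumes "Z \<in> carrier_mat d1 d2"
  shows "frob_inner Z (W Z) = wform Z Z"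
  using assms by (simp add: frob_inner_def wform_W)

lemma wform_nonneg: "0 \<le> wform Z Z"
  unfolding wform_def
proof (intro sum_nonneg)
  show "0 \<le> H i j * (coord Z (i,j) * coord Z (i,j))" for i j
    using H_pos[of i j] by simp
qed

lemma wform_eq_0:
  assumes "wform Z Z = 0" "i < d1" "j < d2"
  shows "coord Z (i,j) = 0"
proof -
  have nn: "0 \<le> H i j * (coord Z (i,j) * coord Z (i,j))" for i j
    using H_pos[of i j] by simp
  have "\<forall>i\<in>{..<d1}. (\<Sum>j<d2. H i j * (coord Z (i,j) * coord Z (i,j))) = 0"
    using assms(1) unfolding wform_def
    by (subst sum_nonneg_eq_0_iff[symmetric]) (auto intro!: sum_nonneg nn)
  then have "\<forall>j\<in>{..<d2}. H i j * (coord Z (i,j) * coord Z (i,j)) = 0"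
    using assms(2) by (subst sum_nonneg_eq_0_iff[symmetric]) (auto intro!: nn)
  then have "H i j * (coord Z (i,j) * coord Z (i,j)) = 0" using assms(3) by blast
  then show ?thesis using H_pos[of i j] by simp
qed

lemma wform_line:
  assumes "Z \<in> carrier_mat d1 d2" "Y \<in> carrier_mat d1 d2"
  shows "wform (Z + x \<cdot>\<^sub>m Y) (Z + x \<cdot>\<^sub>m Y) = wform Z Z + 2 * x * wform Y Z + x\<^sup>2 * wform Y Y"
  unfolding wform_def
  by (simp add: coord_lincomb[OF assms] sum.distrib[symmetric] sum_distrib_left algebra_simps power2_eq_square)

text \<open>First-order optimality: changing an unsampled entry of \<open>X\<close> by
  \<open>t\<close> keeps it feasible, so a quadratic polynomial in \<open>t\<close> without constant
  term is nonnegative, and its linear coefficient, twice this entry of \<open>W X\<close>, must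
  vanish. This puts \<open>W X\<close> into the range of \<open>sample_adj\<close>.\<close>

lemma minimizer_outside:
  assumes "wls_minimizer d1 d2 \<Omega> y W X" "set \<Omega> \<subseteq> {..<d1} \<times> {..<d2}"
    and "(a,b) \<notin> set \<Omega>" "a < d1" "b < d2"
  shows "W X $$ (a,b) = 0"
proof -
  have X: "X \<in> carrier_mat d1 d2" "sample \<Omega> X = y"
    using assms(1) by (auto simp: wls_minimizer_def is_arg_min_def)
  have min: "\<not> frob_inner Z (W Z) < frob_inner X (W X)"
      if "Z \<in> carrier_mat d1 d2" "sample \<Omega> Z = y" for Z
    using assms(1) that by (auto simp: wls_minimizer_def is_arg_min_def)
  define Y where "Y = mat d1 d2 (\<lambda>ij. if ij = (a,b) then 1 else 0 :: real)"
  have Y: "Y \<in> carrier_mat d1 d2" by (simp add: Y_def)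
  let ?\<beta> = "wform Y X" and ?q = "wform Y Y"
  have \<beta>: "?\<beta> = W X $$ (a,b)"
  proof -
    have "?\<beta> = (\<Sum>i<d1. \<Sum>j<d2. if i = a then if j = b then W X $$ (i,j) else 0 else 0)"
      using X by (auto simp: wform_W Y_def intro!: sum.cong)
    also have "\<dots> = (\<Sum>i<d1. if i = a then W X $$ (i,b) else 0)"
      using assms(5) by (intro sum.cong) auto
    finally show ?thesis using assms(4) by simp
  qed
  have "0 \<le> 2 * t * ?\<beta> + t\<^sup>2 * ?q" for t
  proof -
    have "sample \<Omega> (X + t \<cdot>\<^sub>m Y) = y"
    proof (rule eq_vecI)
      fix l assume "l < dim_vec y"
      then have l: "l < length \<Omega>" "\<Omega> ! l \<in> set \<Omega>" using X(2) by (auto simp: sample_def)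
      then have "\<Omega> ! l \<in> {..<d1} \<times> {..<d2}" "\<Omega> ! l \<noteq> (a,b)"
        using assms(2,3) by (blast, metis)
      then have "(X + t \<cdot>\<^sub>m Y) $$ (\<Omega> ! l) = X $$ (\<Omega> ! l)"
        using X Y by (cases "\<Omega> ! l") (auto simp: Y_def)
      then show "sample \<Omega> (X + t \<cdot>\<^sub>m Y) $ l = y $ l"
        using l unfolding X(2)[symmetric] by (simp add: sample_def)
    qed (simp add: sample_def flip: X(2))
    moreover have "X + t \<cdot>\<^sub>m Y \<in> carrier_mat d1 d2" using X Y by simp
    ultimately have "wform X X \<le> wform (X + t \<cdot>\<^sub>m Y) (X + t \<cdot>\<^sub>m Y)"
      using min X by (fastforce simp: frob_inner_W)
    then show ?thesis by (simp add: wform_line[OF X(1) Y])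
  qed
  note ineq = this
  \<comment> \<open>Nearly the minimizer of the quadratic. The added 1 makes the denominator
    positive without knowing \<open>?q > 0\<close>, and the value becomes
    \<open>-t^2 (?q + 2)\<close>.\<close>
  define t where "t = - ?\<beta> / (?q + 1)"
  have q: "0 \<le> ?q" by (rule wform_nonneg)
  then have t: "?\<beta> = - (t * (?q + 1))" by (simp add: t_def)
  have "2 * t * ?\<beta> + t\<^sup>2 * ?q = - (t\<^sup>2 * (?q + 2))"
    unfolding t by (simp add: algebra_simps power2_eq_square)
  then have "t\<^sup>2 * (?q + 2) \<le> 0" using ineq[of t] by simp
  then have "t = 0" using q by (simp add: mult_le_0_iff)
  then have "?\<beta> = 0" using t by simp
  then show ?thesis using \<beta> by simp
qed

text \<open>The difference \<open>X - X'\<close> vanishes on the samples and \<open>W X'\<close>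
  vanishes off them, so the two are orthogonal and the objective at \<open>X\<close> is that at
  \<open>X'\<close> plus the form of the difference. Minimality of \<open>X\<close> makes this last
  term zero, and the form is definite.\<close>

lemma minimizer_unique:
  assumes "wls_minimizer d1 d2 \<Omega> y W X" "set \<Omega> \<subseteq> {..<d1} \<times> {..<d2}"
    and X': "X' \<in> carrier_mat d1 d2" "sample \<Omega> X' = y"
    and outside: "\<And>a b. a < d1 \<Longrightarrow> b < d2 \<Longrightarrow> (a,b) \<notin> set \<Omega> \<Longrightarrow> W X' $$ (a,b) = 0"
  shows "X = X'"
proof -
  have X: "X \<in> carrier_mat d1 d2" "sample \<Omega> X = y"
    and min: "\<not> frob_inner X' (W X') < frob_inner X (W X)"
    using assms(1) X' by (auto simp: wls_minimizer_def is_arg_min_def)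
  define Y where "Y = X - X'"
  have Y: "Y \<in> carrier_mat d1 d2" using X X' by (simp add: Y_def minus_carrier_mat)
  have XY: "X = X' + 1 \<cdot>\<^sub>m Y" using X X' by (intro eq_matI) (auto simp: Y_def)
  have "Y $$ (a,b) * W X' $$ (a,b) = 0" if "a < d1" "b < d2" for a b
  proof (cases "(a,b) \<in> set \<Omega>")
    case True
    then obtain l where l: "l < length \<Omega>" "\<Omega> ! l = (a,b)" by (auto simp: in_set_conv_nth)
    have "sample \<Omega> X $ l = sample \<Omega> X' $ l" using X(2) X'(2) by simp
    then have "X $$ (a,b) = X' $$ (a,b)" using l by (simp add: sample_def)
    then show ?thesis using that X X' by (simp add: Y_def)
  qed (use that outside in simp)
  then have "wform Y X' = 0" unfolding wform_W[OF X'(1)] by (intro sum.neutral ballI) auto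
  then have "wform X X = wform X' X' + wform Y Y"
    by (subst (1 2) XY) (simp only: wform_line[OF X'(1) Y], simp)
  then have "wform Y Y = 0"
    using min X X' wform_nonneg[of Y] by (simp add: frob_inner_W)
  then have "coord X (i,j) = coord X' (i,j)" if "i < d1" "j < d2" for i j
    using wform_eq_0[OF _ that] coord_lincomb[OF X'(1) Y, of 1 "(i,j)"] XY by simp
  then show ?thesis using X X' by (intro mat_eq_of_coord_eq) auto
qed

section \<open>From the linear system to the minimizer and its shape\<close>

lemma H_outside:
  assumes "i < d1" "j < d2" "(i,j) \<notin> I"
  shows "H i j = inverse (e\<^sup>2)"
  using assms by (auto simp: weight_def max_s tangent_idx_def power2_eq_square)

text \<open>On \<open>I\<close> at least one of the two factors exceeds \<open>e\<close> strictly.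
  Hence the inverse in the diagonal part of the system is a genuine one and positive.\<close>

lemma H_inside:
  assumes "(i,j) \<in> I"
  shows "e\<^sup>2 < inverse (H i j)"
proof -
  have "e * e < max (s i) e * max (s j) e"
    using assms e_pos s_high[of i] s_high[of j]
    by (auto simp: tangent_idx_def max_s power2_eq_square intro!: mult_strict_mono mult_strict_left_mono mult_strict_right_mono)
  then show ?thesis by (simp add: inverse_H power2_eq_square)
qed

text \<open>Let \<open>S\<close> be the adjoint applied to the misfit of the samples. An equation of
  the system says \<open>g = (inverse H - e^2) S / e^2\<close> at its coordinate, that is,
  \<open>H (S + g) = S / e^2\<close>. Off \<open>I\<close> the same holds because \<open>g\<close>
  is absent and \<open>H\<close> is \<open>e^-2\<close>. So \<open>W ?X = S / e^2\<close> is
  supported on the samples.\<close>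

lemma minimizer_from_system:
  assumes "wls_minimizer d1 d2 \<Omega> y W X" "distinct \<Omega>" "set \<Omega> \<subseteq> {..<d1} \<times> {..<d2}"
    and y: "y \<in> carrier_vec (length \<Omega>)"
    and sys: "\<And>p. p \<in> I \<Longrightarrow> system_op d1 d2 \<Omega> r e U s V g p = system_rhs d1 d2 \<Omega> y U V p"
  shows "X = matrix_of_coords d1 d2 \<Omega> y r U V g"
proof -
  let ?Z = "tangent_map d1 d2 r U V g"
  define w where "w = y - sample \<Omega> ?Z"
  define S where "S = sample_adj d1 d2 \<Omega> w"
  have w: "w \<in> carrier_vec (length \<Omega>)" using y by (simp add: w_def sample_def)
  have S [simp]: "S \<in> carrier_mat d1 d2" by (simp add: S_def)
  have Seq: "coord S ij = coord (sample_adj d1 d2 \<Omega> y) ij - coord (sample_adj d1 d2 \<Omega> (sample \<Omega> ?Z)) ij" for ij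
  proof -
    have "S = sample_adj d1 d2 \<Omega> y + (-1) \<cdot>\<^sub>m sample_adj d1 d2 \<Omega> (sample \<Omega> ?Z)"
      using y by (intro eq_matI)
        (auto simp: S_def w_def sample_adj_def sample_def sum_subtractf[symmetric] intro!: sum.cong)
    then show ?thesis by (simp add: coord_lincomb)
  qed
  let ?X = "S + ?Z"
  have X: "?X \<in> carrier_mat d1 d2" by simp
  have cX: "coord ?X (i,j) = coord S (i,j) + (if (i,j) \<in> I then g (i,j) else 0)"
    if "i < d1" "j < d2" for i j
  proof -
    have "?X = S + 1 \<cdot>\<^sub>m ?Z" by (intro eq_matI) auto
    then show ?thesis using that by (simp add: coord_lincomb coord_tangent_map)
  qed
  have "sample \<Omega> ?X = y"
  proof (rule eq_vecI)
    fix l assume "l < dim_vec y"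
    then have l: "l < length \<Omega>" using y by simp
    then have "\<Omega> ! l \<in> {..<d1} \<times> {..<d2}" using assms(3) nth_mem by blast
    then have "?X $$ (\<Omega> ! l) = S $$ (\<Omega> ! l) + ?Z $$ (\<Omega> ! l)"
      by (cases "\<Omega> ! l") (auto simp: carrier_matD[OF S] carrier_matD[OF tangent_map_carrier])
    also have "S $$ (\<Omega> ! l) = w $ l"
      using arg_cong[OF sample_sample_adj[OF assms(2,3) w], of "\<lambda>v. v $ l"] l
      by (simp add: S_def sample_def)
    finally show "sample \<Omega> ?X $ l = y $ l" using l y by (simp add: sample_def w_def)
  qed (use y in \<open>simp add: sample_def\<close>)
  moreover have "W ?X $$ (a,b) = 0" if "a < d1" "b < d2" "(a,b) \<notin> set \<Omega>" for a b
  proof -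
    have "H i j * coord ?X (i,j) = inverse (e\<^sup>2) * coord S (i,j)" if ij: "i < d1" "j < d2" for i j
    proof (cases "(i,j) \<in> I")
      case True
      have "e\<^sup>2 * inverse (inverse (H i j) - e\<^sup>2) * g (i,j) = coord S (i,j)"
        using sys[OF True] by (simp add: system_op_def system_rhs_def Seq)
      moreover have "inverse (H i j) - e\<^sup>2 > 0" using H_inside[OF True] by simp
      ultimately have "g (i,j) = (inverse (H i j) - e\<^sup>2) * coord S (i,j) / e\<^sup>2"
        using e_pos by (simp add: field_simps)
      then show ?thesis
        using ij True H_pos[of i j] e_pos by (simp add: cX field_simps)
    qed (simp add: cX ij H_outside)
    then have "W ?X $$ (a,b) = inverse (e\<^sup>2) * expand (coord S) a b"
      unfolding W_expand[OF X that(1,2)] by (simp add: expand_def sum_distrib_left mult_ac)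
    also have "\<dots> = 0"
      using that by (simp add: expand_coord S_def sample_adj_outside)
    finally show ?thesis .
  qed
  ultimately have "X = ?X" by (intro minimizer_unique[OF assms(1,3) X])
  then show ?thesis by (simp add: matrix_of_coords_def S_def w_def)
qed

text \<open>The form of the new iterate follows from optimality alone, whether or not the linear
  system is solved.\<close>

lemma minimizer_representation:
  assumes "wls_minimizer d1 d2 \<Omega> y W X" "distinct \<Omega>" "set \<Omega> \<subseteq> {..<d1} \<times> {..<d2}"
  obtains \<rho> g where "\<rho> \<in> carrier_vec (length \<Omega>)"
    "X = sample_adj d1 d2 \<Omega> \<rho> + tangent_map d1 d2 r U V g"
proof -
  have X: "X \<in> carrier_mat d1 d2" using assms(1) by (simp add: wls_minimizer_def is_arg_min_def)
  define \<rho> where "\<rho> = vec (length \<Omega>) (\<lambda>l. e\<^sup>2 * W X $$ (\<Omega> ! l))"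
  \<comment> \<open>These are the coordinates of \<open>X - e^2 W X\<close>, with
    \<open>coord X\<close> expressed by \<open>coord (W X)\<close>. They vanish off
    \<open>I\<close>.\<close>
  define g where "g = (\<lambda>(i,j). (inverse (H i j) - e\<^sup>2) * coord (W X) (i,j))"
  let ?S = "sample_adj d1 d2 \<Omega> \<rho>" and ?Z = "tangent_map d1 d2 r U V g"
  have "?S $$ (a,b) = e\<^sup>2 * W X $$ (a,b)" if "a < d1" "b < d2" for a b
  proof (cases "(a,b) \<in> set \<Omega>")
    case True
    then obtain l where "l < length \<Omega>" "\<Omega> ! l = (a,b)" by (auto simp: in_set_conv_nth)
    then show ?thesis using sample_adj_nth[OF assms(2)] that by (simp add: \<rho>_def)
  next
    case False
    then show ?thesis using minimizer_outside[OF assms(1,3) False] that by (simp add: sample_adj_outside)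
  qed
  then have "coord ?S ij = e\<^sup>2 * coord (W X) ij" for ij
    by (cases ij) (simp add: tangent_adj_def sum_distrib_left mult_ac)
  moreover have "?S + 1 \<cdot>\<^sub>m ?Z = ?S + ?Z" by (intro eq_matI) auto
  ultimately have "coord (?S + ?Z) (i,j) = coord X (i,j)" if "i < d1" "j < d2" for i j
    using that coord_lincomb[of ?S ?Z 1 "(i,j)"] H_pos[of i j] H_outside[OF that] e_pos
    by (simp add: coord_tangent_map g_def coord_W[OF X] algebra_simps)
  then have XSZ: "X = ?S + ?Z" using X by (intro mat_eq_of_coord_eq) auto
  show ?thesis by (rule that[OF _ XSZ]) (simp add: \<rho>_def)
qed

end

section \<open>Building blocks of the program\<close>

notation Seq (infixr ";;" 60)

definition cell :: "string \<Rightarrow> rexp" where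
  "cell a = Cell a (Reg ''i'') (Reg ''j'')"

definition scal :: "string \<Rightarrow> rexp" where
  "scal a = Cell a (ILit 0) (ILit 0)"

definition add_block :: "string \<Rightarrow> string \<Rightarrow> string \<Rightarrow> rexp \<Rightarrow> cmd" where
  "add_block a n l p = accumulate [(''i'', Reg n), (''j'', Reg l)] a (Reg ''i'') (Reg ''j'') p"

definition add_product :: "string \<Rightarrow> string \<Rightarrow> string \<Rightarrow> string \<Rightarrow> rexp \<Rightarrow> cmd" where
  "add_product a n l k p =
     accumulate [(''i'', Reg n), (''j'', Reg l), (''k'', Reg k)] a (Reg ''i'') (Reg ''j'') p"

text \<open>The arrays named \<open>g\<close> followed by \<open>G\<close>, \<open>A\<close>, \<open>B\<close> hold core, right and left factor.\<close>

definition vec_zero :: "char \<Rightarrow> cmd" where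
  "vec_zero g =
     zero_block [g, CHR ''G''] (Reg ''r'') (Reg ''r'') ;;
     zero_block [g, CHR ''A''] (Reg ''d2'') (Reg ''r'') ;;
     zero_block [g, CHR ''B''] (Reg ''d1'') (Reg ''r'')"

definition vec_add :: "char \<Rightarrow> (char \<Rightarrow> rexp) \<Rightarrow> cmd" where
  "vec_add g p =
     add_block [g, CHR ''G''] ''r'' ''r'' (p CHR ''G'') ;;
     add_block [g, CHR ''A''] ''d2'' ''r'' (p CHR ''A'') ;;
     add_block [g, CHR ''B''] ''d1'' ''r'' (p CHR ''B'')"

definition vec_axpy :: "char \<Rightarrow> rexp \<Rightarrow> char \<Rightarrow> cmd" where
  "vec_axpy g q h = vec_add g (\<lambda>c. Mul q (cell [h, c]))"

text \<open>Copying is zeroing followed by accumulation, so the correctness of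
  \<open>vec_axpy\<close> also covers it.\<close>

definition vec_copy :: "char \<Rightarrow> char \<Rightarrow> cmd" where
  "vec_copy g h =
     vec_zero g ;;
     vec_axpy g (RLit 1) h"

definition vec_inner :: "string \<Rightarrow> char \<Rightarrow> char \<Rightarrow> cmd" where
  "vec_inner a g h =
     (let part = (\<lambda>c n. accumulate [(''i'', Reg n), (''j'', Reg ''r'')] a (ILit 0) (ILit 0)
                    (Mul (cell [g, c]) (cell [h, c])))
      in Store a (ILit 0) (ILit 0) (RLit 0) ;;
         part CHR ''G'' ''r'' ;; part CHR ''A'' ''d2'' ;; part CHR ''B'' ''d1'')"

text \<open>\<open>E\<close> receives \<open>ext_core\<close> once, at cost of order
  \<open>d2 r^2\<close>; afterwards each sample needs only \<open>r\<close> passes.\<close>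

definition sample_prog :: cmd where
  "sample_prog =
     zero_block ''E'' (Reg ''d2'') (Reg ''r'') ;;
     add_block ''E'' ''d2'' ''r'' (cell ''PA'') ;;
     add_product ''E'' ''d2'' ''r'' ''r''
       (Mul (Cell ''PG'' (Reg ''j'') (Reg ''k'')) (Cell ''V'' (Reg ''i'') (Reg ''k''))) ;;
     zero_block ''R'' (Reg ''m'') (ILit 1) ;;
     accumulate [(''i'', Reg ''m''), (''k'', Reg ''r'')] ''R'' (Reg ''i'') (ILit 0)
       (Add (Mul (Cell ''U'' (Lookup ''row'' (Reg ''i'')) (Reg ''k''))
                 (Cell ''E'' (Lookup ''col'' (Reg ''i'')) (Reg ''k'')))
            (Mul (Cell ''PB'' (Lookup ''row'' (Reg ''i'')) (Reg ''k''))
                 (Cell ''V'' (Lookup ''col'' (Reg ''i'')) (Reg ''k''))))"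

text \<open>
  \<open>F\<close> and \<open>K\<close> hold \<open>Z\<^sup>T U\<^sub>r\<close> and \<open>Z V\<^sub>r\<close> in \<open>adjoint_prog\<close>, where their cores \<open>H\<close> and \<open>L\<close>
  coincide; in \<open>load_prog\<close> they hold the two input factors, whose cores add up.
\<close>

definition project_prog :: cmd where
  "project_prog =
     zero_block ''H'' (Reg ''r'') (Reg ''r'') ;;
     add_product ''H'' ''r'' ''r'' ''d2''
       (Mul (Cell ''V'' (Reg ''k'') (Reg ''j'')) (Cell ''F'' (Reg ''k'') (Reg ''i''))) ;;
     zero_block ''L'' (Reg ''r'') (Reg ''r'') ;;
     add_product ''L'' ''r'' ''r'' ''d1''
       (Mul (Cell ''U'' (Reg ''k'') (Reg ''i'')) (Cell ''K'' (Reg ''k'') (Reg ''j''))) ;;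
     vec_zero CHR ''W'' ;;
     add_block ''WA'' ''d2'' ''r'' (cell ''F'') ;;
     add_product ''WA'' ''d2'' ''r'' ''r''
       (Sub (RLit 0) (Mul (Cell ''H'' (Reg ''j'') (Reg ''k'')) (Cell ''V'' (Reg ''i'') (Reg ''k'')))) ;;
     add_block ''WB'' ''d1'' ''r'' (cell ''K'') ;;
     add_product ''WB'' ''d1'' ''r'' ''r''
       (Sub (RLit 0) (Mul (Cell ''L'' (Reg ''k'') (Reg ''j'')) (Cell ''U'' (Reg ''i'') (Reg ''k''))))"

text \<open>Each sample adds a multiple of one row of \<open>U_r\<close> or \<open>V_r\<close>, so
  the sparse products cost order \<open>m r\<close> and no \<open>d1\<close> by \<open>d2\<close>
  matrix is formed. The projection leaves the core of \<open>W\<close> zero, and \<open>H\<close> is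
  added to it at the end.\<close>

definition adjoint_prog :: cmd where
  "adjoint_prog =
     zero_block ''F'' (Reg ''d2'') (Reg ''r'') ;;
     accumulate [(''i'', Reg ''m''), (''j'', Reg ''r'')] ''F'' (Lookup ''col'' (Reg ''i'')) (Reg ''j'')
       (Mul (Cell ''R'' (Reg ''i'') (ILit 0)) (Cell ''U'' (Lookup ''row'' (Reg ''i'')) (Reg ''j''))) ;;
     zero_block ''K'' (Reg ''d1'') (Reg ''r'') ;;
     accumulate [(''i'', Reg ''m''), (''j'', Reg ''r'')] ''K'' (Lookup ''row'' (Reg ''i'')) (Reg ''j'')
       (Mul (Cell ''R'' (Reg ''i'') (ILit 0)) (Cell ''V'' (Lookup ''col'' (Reg ''i'')) (Reg ''j''))) ;;
     project_prog ;;
     add_block ''WG'' ''r'' ''r'' (cell ''H'')"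

text \<open>A trailing index enters the weight as \<open>e\<close>, so on the factors the diagonal
  operator scales whole columns. The column number of either factor is its leading index, hence
  \<open>sigma\<close> at \<open>j\<close> in all three cases.\<close>

definition weight_prog :: cmd where
  "weight_prog = vec_add CHR ''W'' (\<lambda>c.
     let ee = Mul (scal ''eps'') (scal ''eps'');
         left = (if c = CHR ''G'' then Cell ''sigma'' (Reg ''i'') (ILit 0) else scal ''eps'')
     in Mul (Div ee (Sub (Mul left (Cell ''sigma'' (Reg ''j'') (ILit 0))) ee)) (cell [CHR ''P'', c]))"

definition operator_prog :: cmd where
  "operator_prog =
     sample_prog ;;
     adjoint_prog ;;
     weight_prog"

definition load_prog :: cmd where
  "load_prog =
     zero_block ''F'' (Reg ''d2'') (Reg ''r'') ;;
     add_block ''F'' ''d2'' ''r'' (cell ''A0'') ;;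
     zero_block ''K'' (Reg ''d1'') (Reg ''r'') ;;
     add_block ''K'' ''d1'' ''r'' (cell ''B0'') ;;
     project_prog ;;
     add_block ''WG'' ''r'' ''r'' (Add (cell ''H'') (cell ''L''))"

text \<open>Operator and right-hand side both pass through \<open>R\<close> and end in
  \<open>W\<close>. The negated operator part is therefore saved in \<open>Q\<close> before
  \<open>R\<close> is refilled with the data.\<close>

definition residual_prog :: cmd where
  "residual_prog =
     operator_prog ;;
     vec_zero CHR ''Q'' ;;
     vec_axpy CHR ''Q'' (RLit (- 1)) CHR ''W'' ;;
     zero_block ''R'' (Reg ''m'') (ILit 1) ;;
     accumulate [(''i'', Reg ''m'')] ''R'' (Reg ''i'') (ILit 0) (Cell ''y'' (Reg ''i'') (ILit 0)) ;;
     adjoint_prog ;;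
     vec_axpy CHR ''Q'' (RLit 1) CHR ''W''"

definition init_prog :: cmd where
  "init_prog =
     load_prog ;;
     vec_copy CHR ''P'' CHR ''W'' ;;
     vec_copy CHR ''X'' CHR ''W'' ;;
     residual_prog ;;
     vec_copy CHR ''P'' CHR ''Q''"

text \<open>No block scales an array in place, so the new direction is assembled in
  \<open>W\<close>, whose content is no longer needed, and then copied to \<open>P\<close>.\<close>

definition cg_prog :: cmd where
  "cg_prog =
     operator_prog ;;
     vec_inner ''rho'' CHR ''Q'' CHR ''Q'' ;;
     vec_inner ''tau'' CHR ''P'' CHR ''W'' ;;
     Store ''alpha'' (ILit 0) (ILit 0) (Div (scal ''rho'') (scal ''tau'')) ;;
     vec_axpy CHR ''X'' (scal ''alpha'') CHR ''P'' ;;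
     vec_axpy CHR ''Q'' (Sub (RLit 0) (scal ''alpha'')) CHR ''W'' ;;
     vec_inner ''tau'' CHR ''Q'' CHR ''Q'' ;;
     Store ''beta'' (ILit 0) (ILit 0) (Div (scal ''tau'') (scal ''rho'')) ;;
     vec_copy CHR ''W'' CHR ''Q'' ;;
     vec_axpy CHR ''W'' (scal ''beta'') CHR ''P'' ;;
     vec_copy CHR ''P'' CHR ''W''"

definition output_prog :: cmd where
  "output_prog =
     vec_copy CHR ''P'' CHR ''X'' ;;
     sample_prog ;;
     zero_block ''res'' (Reg ''m'') (ILit 1) ;;
     accumulate [(''i'', Reg ''m'')] ''res'' (Reg ''i'') (ILit 0)
       (Sub (Cell ''y'' (Reg ''i'') (ILit 0)) (Cell ''R'' (Reg ''i'') (ILit 0))) ;;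
     zero_block ''M1'' (Reg ''d2'') (Reg ''r'') ;;
     add_block ''M1'' ''d2'' ''r'' (cell ''E'') ;;
     zero_block ''M2'' (Reg ''d1'') (Reg ''r'') ;;
     add_block ''M2'' ''d1'' ''r'' (cell ''PB'')"

definition step_prog :: cmd where
  "step_prog =
     init_prog ;;
     For ''n'' (Reg ''N'') cg_prog ;;
     output_prog"

lemmas step_prog_unfold =
  step_prog_def init_prog_def load_prog_def residual_prog_def operator_prog_def
  sample_prog_def adjoint_prog_def project_prog_def weight_prog_def cg_prog_def output_prog_def
  vec_zero_def vec_add_def vec_axpy_def vec_copy_def vec_inner_def Let_def
  zero_block_def add_block_def add_product_def accumulate_simps

section \<open>Frame facts and effects of the building blocks\<close>

lemma writes_zero_block [simp]: "writes (zero_block a n l) = {a}"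
  and lregs_zero_block [simp]: "lregs (zero_block a n l) = {''i'', ''j''}"
  by (auto simp: zero_block_def)

lemma writes_blocks [simp]:
  "writes (add_block a n l p) = {a}" "writes (add_product a n l k p) = {a}"
  "writes (vec_zero g) = {[g, CHR ''G''], [g, CHR ''A''], [g, CHR ''B'']}"
  "writes (vec_add g pf) = {[g, CHR ''G''], [g, CHR ''A''], [g, CHR ''B'']}"
  "writes (vec_axpy g q h) = {[g, CHR ''G''], [g, CHR ''A''], [g, CHR ''B'']}"
  "writes (vec_copy g h) = {[g, CHR ''G''], [g, CHR ''A''], [g, CHR ''B'']}"
  "writes (vec_inner a g h) = {a}"
  by (auto simp: add_block_def add_product_def vec_zero_def vec_add_def vec_axpy_def vec_copy_def
      vec_inner_def Let_def)

lemma lregs_blocks [simp]: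
  "lregs (add_block a n l p) = {''i'', ''j''}" "lregs (add_product a n l k p) = {''i'', ''j'', ''k''}"
  "lregs (vec_zero g) = {''i'', ''j''}" "lregs (vec_add g pf) = {''i'', ''j''}"
  "lregs (vec_axpy g q h) = {''i'', ''j''}" "lregs (vec_copy g h) = {''i'', ''j''}"
  "lregs (vec_inner a g h) = {''i'', ''j''}"
  by (auto simp: add_block_def add_product_def vec_zero_def vec_add_def vec_axpy_def vec_copy_def
      vec_inner_def Let_def)

lemma writes_progs [simp]:
  "writes sample_prog = {''E'', ''R''}"
  "writes project_prog = {''H'', ''L'', ''WG'', ''WA'', ''WB''}"
  "writes adjoint_prog = {''F'', ''K'', ''H'', ''L'', ''WG'', ''WA'', ''WB''}"
  "writes weight_prog = {''WG'', ''WA'', ''WB''}"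
  "writes operator_prog = {''E'', ''R'', ''F'', ''K'', ''H'', ''L'', ''WG'', ''WA'', ''WB''}"
  by (auto simp: sample_prog_def project_prog_def adjoint_prog_def weight_prog_def operator_prog_def)

lemma lregs_progs [simp]:
  "lregs sample_prog = {''i'', ''j'', ''k''}" "lregs project_prog = {''i'', ''j'', ''k''}"
  "lregs adjoint_prog = {''i'', ''j'', ''k''}" "lregs weight_prog = {''i'', ''j''}"
  "lregs operator_prog = {''i'', ''j'', ''k''}"
  by (auto simp: sample_prog_def project_prog_def adjoint_prog_def weight_prog_def operator_prog_def)

lemma rval_cell [simp]: "rval st (cell a) = rarr st a (regs st ''i'') (regs st ''j'')"
  and rval_scal [simp]: "rval st (scal a) = rarr st a 0 0"
  and rreads_cell [simp]: "rreads (cell a) = {a}"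
  and rreads_scal [simp]: "rreads (scal a) = {a}"
  by (auto simp: cell_def scal_def)

lemma sum_delta2:
  fixes n l :: nat
  shows "(\<Sum>v<n. \<Sum>w<l. if v = i \<and> w = j then f v w else 0) = (if i < n \<and> j < l then f i j else (0::real))"
proof -
  have "(\<Sum>v<n. \<Sum>w<l. if v = i \<and> w = j then f v w else 0) =
      (\<Sum>v<n. if v = i then (\<Sum>w<l. if w = j then f v w else 0) else 0)"
    by (intro sum.cong) auto
  then show ?thesis by simp
qed

lemma rarr_add_block:
  assumes "a \<notin> rreads p" "n \<notin> {''i'', ''j''}" "l \<notin> {''i'', ''j''}"
  shows "rarr (run (add_block a n l p) st) a i j = rarr st a i j +
    (if i < regs st n \<and> j < regs st l
     then rval (st \<lparr> regs := (regs st)(''i'' := i, ''j'' := j) \<rparr>) p else 0)"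
  using assms unfolding add_block_def by (subst rarr_accumulate) (auto simp: sum_delta2)

lemma rarr_add_product:
  assumes "a \<notin> rreads p" "n \<notin> {''i'', ''j'', ''k''}" "l \<notin> {''i'', ''j'', ''k''}" "k \<notin> {''i'', ''j'', ''k''}"
  shows "rarr (run (add_product a n l k p) st) a i j = rarr st a i j +
    (if i < regs st n \<and> j < regs st l
     then (\<Sum>t<regs st k. rval (st \<lparr> regs := (regs st)(''i'' := i, ''j'' := j, ''k'' := t) \<rparr>) p) else 0)"
proof -
  have "(\<Sum>v<n'. \<Sum>w<l'. \<Sum>t<k'. if v = i \<and> w = j then f v w t else 0) =
      (if i < n' \<and> j < l' then (\<Sum>t<k'. f i j t) else (0::real))" for n' l' k' :: nat and f
    unfolding sum_delta2[of i j "\<lambda>v w. \<Sum>t<k'. f v w t", symmetric] by (intro sum.cong) auto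
  then show ?thesis
    using assms unfolding add_product_def by (subst rarr_accumulate) auto
qed

lemma rarr_add_rows:
  assumes "a \<notin> rreads p" "n \<noteq> ''i''"
  shows "rarr (run (accumulate [(''i'', Reg n)] a (Reg ''i'') (ILit 0) p) st) a i 0 = rarr st a i 0 +
    (if i < regs st n then rval (st \<lparr> regs := (regs st)(''i'' := i) \<rparr>) p else 0)"
  using assms by (subst rarr_accumulate) auto

lemmas rarr_updates = rarr_add_block rarr_add_product rarr_zero_block rarr_run

section \<open>Correctness of the program\<close>

locale irls_step = weighted_bases +
  fixes \<Omega> :: "(nat \<times> nat) list" and y :: "real vec" and N :: nat
  assumes \<Omega>: "set \<Omega> \<subseteq> {..<d1} \<times> {..<d2}" and y: "y \<in> carrier_vec (length \<Omega>)"
begin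

text \<open>The memory that all blocks may rely on and none overwrites. The initial factors are
  absent because only the loading phase reads them.\<close>

definition ctx :: "mstate \<Rightarrow> bool" where
  "ctx st \<longleftrightarrow>
     regs st ''d1'' = d1 \<and> regs st ''d2'' = d2 \<and> regs st ''m'' = length \<Omega> \<and>
     regs st ''r'' = r \<and> regs st ''N'' = N \<and>
     (\<forall>l<length \<Omega>. iarr st ''row'' l = fst (\<Omega> ! l) \<and> iarr st ''col'' l = snd (\<Omega> ! l)) \<and>
     (\<forall>l<length \<Omega>. rarr st ''y'' l 0 = y $ l) \<and> rarr st ''eps'' 0 0 = e \<and>
     (\<forall>i<r. rarr st ''sigma'' i 0 = s i) \<and>
     (\<forall>a<d1. \<forall>i<r. rarr st ''U'' a i = U $$ (a,i)) \<and>
     (\<forall>b<d2. \<forall>j<r. rarr st ''V'' b j = V $$ (b,j))"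

lemma ctxD:
  assumes "ctx st"
  shows "regs st ''d1'' = d1" "regs st ''d2'' = d2" "regs st ''m'' = length \<Omega>"
    "regs st ''r'' = r" "regs st ''N'' = N"
    "l < length \<Omega> \<Longrightarrow> iarr st ''row'' l = fst (\<Omega> ! l)"
    "l < length \<Omega> \<Longrightarrow> iarr st ''col'' l = snd (\<Omega> ! l)"
    "l < length \<Omega> \<Longrightarrow> rarr st ''y'' l 0 = y $ l" "rarr st ''eps'' 0 0 = e"
    "i < r \<Longrightarrow> rarr st ''sigma'' i 0 = s i"
    "a < d1 \<Longrightarrow> i < r \<Longrightarrow> rarr st ''U'' a i = U $$ (a,i)"
    "b < d2 \<Longrightarrow> j < r \<Longrightarrow> rarr st ''V'' b j = V $$ (b,j)"
  using assms by (auto simp: ctx_def)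

lemma ctx_run:
  assumes "ctx st" "lregs c \<subseteq> {''i'', ''j'', ''k''}"
    "{''y'', ''eps'', ''sigma'', ''U'', ''V''} \<inter> writes c = {}"
  shows "ctx (run c st)"
proof -
  have "regs (run c st) x = regs st x" if "x \<in> {''d1'', ''d2'', ''m'', ''r'', ''N''}" for x
    using assms(2) that by (intro regs_run) auto
  moreover have "rarr (run c st) a = rarr st a" if "a \<in> {''y'', ''eps'', ''sigma'', ''U'', ''V''}" for a
    using assms(3) that by (intro rarr_run) blast
  ultimately show ?thesis using assms(1) unfolding ctx_def iarr_run by simp
qed

lemma ctx_tick: "ctx st \<Longrightarrow> ctx (tick n (st \<lparr> regs := (regs st)(''n'' := v) \<rparr>))"
  by (simp add: ctx_def)

lemma \<Omega>_bounds: "l < length \<Omega> \<Longrightarrow> fst (\<Omega> ! l) < d1" "l < length \<Omega> \<Longrightarrow> snd (\<Omega> ! l) < d2"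
proof -
  have "\<Omega> ! l \<in> {..<d1} \<times> {..<d2}" if "l < length \<Omega>" using \<Omega> nth_mem[OF that] by blast
  then show "l < length \<Omega> \<Longrightarrow> fst (\<Omega> ! l) < d1" "l < length \<Omega> \<Longrightarrow> snd (\<Omega> ! l) < d2"
    by (auto simp: mem_Times_iff)
qed

section \<open>Arithmetic of stored coordinate vectors\<close>

definition holds :: "char \<Rightarrow> (nat \<times> nat \<Rightarrow> real) \<Rightarrow> mstate \<Rightarrow> bool" where
  "holds g \<gamma> st \<longleftrightarrow>
     (\<forall>i<r. \<forall>j<r. rarr st [g, CHR ''G''] i j = \<gamma> (i,j)) \<and>
     (\<forall>b<d2. \<forall>i<r. rarr st [g, CHR ''A''] b i = right_factor \<gamma> b i) \<and>
     (\<forall>a<d1. \<forall>j<r. rarr st [g, CHR ''B''] a j = left_factor \<gamma> a j)"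

lemma holdsD:
  assumes "holds g \<gamma> st"
  shows "i < r \<Longrightarrow> j < r \<Longrightarrow> rarr st [g, CHR ''G''] i j = \<gamma> (i,j)"
    "b < d2 \<Longrightarrow> i < r \<Longrightarrow> rarr st [g, CHR ''A''] b i = right_factor \<gamma> b i"
    "a < d1 \<Longrightarrow> i < r \<Longrightarrow> rarr st [g, CHR ''B''] a i = left_factor \<gamma> a i"
  using assms by (auto simp: holds_def)

lemma holds_run:
  assumes "holds g \<gamma> st" "{[g, CHR ''G''], [g, CHR ''A''], [g, CHR ''B'']} \<inter> writes c = {}"
  shows "holds g \<gamma> (run c st)"
proof -
  have "rarr (run c st) a = rarr st a" if "a \<in> {[g, CHR ''G''], [g, CHR ''A''], [g, CHR ''B'']}" for a
    using assms(2) that by (intro rarr_run) blast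
  then show ?thesis using assms(1) by (simp add: holds_def)
qed

lemma holds_cong: "holds g \<gamma> st \<Longrightarrow> (\<And>ij. ij \<in> I \<Longrightarrow> \<gamma> ij = \<gamma>' ij) \<Longrightarrow> holds g \<gamma>' st"
  using factors_cong[of \<gamma> \<gamma>'] by (auto simp: holds_def)

lemma holds_tick: "holds g \<gamma> (tick n (st \<lparr> regs := \<rho> \<rparr>)) = holds g \<gamma> st"
  by (simp add: holds_def)

lemma holds_vec_zero: "ctx st \<Longrightarrow> holds g (\<lambda>_. 0) (run (vec_zero g) st)"
  by (simp add: holds_def vec_zero_def rarr_updates regs_run ctxD right_factor_def left_factor_def)

text \<open>The three arrays are updated one after another, so the later expressions are evaluated
  in changed states. As no expression reads an array of \<open>g\<close>, their values are still
  those in \<open>st\<close>.\<close>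

lemma holds_vec_add:
  assumes "ctx st" "holds g \<gamma> st" "\<And>c c'. [g, c'] \<notin> rreads (p c)"
    and G: "\<And>i j. i < r \<Longrightarrow> j < r \<Longrightarrow>
      rval (st \<lparr> regs := (regs st)(''i'' := i, ''j'' := j) \<rparr>) (p CHR ''G'') = \<delta> (i,j)"
    and A: "\<And>b j. b < d2 \<Longrightarrow> j < r \<Longrightarrow>
      rval (st \<lparr> regs := (regs st)(''i'' := b, ''j'' := j) \<rparr>) (p CHR ''A'') = right_factor \<delta> b j"
    and B: "\<And>a j. a < d1 \<Longrightarrow> j < r \<Longrightarrow>
      rval (st \<lparr> regs := (regs st)(''i'' := a, ''j'' := j) \<rparr>) (p CHR ''B'') = left_factor \<delta> a j"
  shows "holds g (\<lambda>ij. \<gamma> ij + \<delta> ij) (run (vec_add g p) st)"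
proof -
  define st1 where "st1 = run (add_block [g, CHR ''G''] ''r'' ''r'' (p CHR ''G'')) st"
  define st2 where "st2 = run (add_block [g, CHR ''A''] ''d2'' ''r'' (p CHR ''A'')) st1"
  have ctx1: "ctx st1" unfolding st1_def by (rule ctx_run) (use assms(1) in auto)
  have ctx2: "ctx st2" unfolding st2_def by (rule ctx_run) (use ctx1 in auto)
  have r1: "rval (st1 \<lparr> regs := (regs st1)(''i'' := i, ''j'' := j) \<rparr>) (p c) =
      rval (st \<lparr> regs := (regs st)(''i'' := i, ''j'' := j) \<rparr>) (p c)" for i j c
  proof (rule rval_cong)
    fix a assume "a \<in> rreads (p c)"
    then have "a \<noteq> [g, CHR ''G'']" using assms(3) by blast
    then show "rarr (st1 \<lparr> regs := (regs st1)(''i'' := i, ''j'' := j) \<rparr>) a =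
        rarr (st \<lparr> regs := (regs st)(''i'' := i, ''j'' := j) \<rparr>) a"
      by (simp add: st1_def rarr_run)
  qed (auto simp: st1_def regs_run fun_eq_iff)
  have r2: "rval (st2 \<lparr> regs := (regs st2)(''i'' := i, ''j'' := j) \<rparr>) (p c) =
      rval (st1 \<lparr> regs := (regs st1)(''i'' := i, ''j'' := j) \<rparr>) (p c)" for i j c
  proof (rule rval_cong)
    fix a assume "a \<in> rreads (p c)"
    then have "a \<noteq> [g, CHR ''A'']" using assms(3) by blast
    then show "rarr (st2 \<lparr> regs := (regs st2)(''i'' := i, ''j'' := j) \<rparr>) a =
        rarr (st1 \<lparr> regs := (regs st1)(''i'' := i, ''j'' := j) \<rparr>) a"
      by (simp add: st2_def rarr_run)
  qed (auto simp: st2_def regs_run fun_eq_iff)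
  have 1: "rarr st1 [g, CHR ''G''] i j = \<gamma> (i,j) + \<delta> (i,j)" if "i < r" "j < r" for i j
    using that assms(1,3) holdsD(1)[OF assms(2)] G unfolding st1_def
    by (subst rarr_add_block) (auto simp: ctxD)
  have 2: "rarr st2 [g, CHR ''A''] b j = right_factor \<gamma> b j + right_factor \<delta> b j"
    if "b < d2" "j < r" for b j
  proof -
    have "rarr st1 [g, CHR ''A''] b j = right_factor \<gamma> b j"
      using that holdsD(2)[OF assms(2)] by (simp add: st1_def rarr_run)
    then show ?thesis
      using that ctx1 assms(3) A unfolding st2_def
      by (subst rarr_add_block) (auto simp: ctxD r1)
  qed
  have 3: "rarr (run (vec_add g p) st) [g, CHR ''B''] a j = left_factor \<gamma> a j + left_factor \<delta> a j"
    if "a < d1" "j < r" for a j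
  proof -
    have "rarr st2 [g, CHR ''B''] a j = left_factor \<gamma> a j"
      using that holdsD(3)[OF assms(2)] by (simp add: st1_def st2_def rarr_run)
    then show ?thesis
      using that ctx2 assms(3) B unfolding vec_add_def run.simps(2) st1_def[symmetric] st2_def[symmetric]
      by (subst rarr_add_block) (auto simp: ctxD r1 r2)
  qed
  have "rarr (run (vec_add g p) st) [g, CHR ''G''] = rarr st1 [g, CHR ''G'']"
    "rarr (run (vec_add g p) st) [g, CHR ''A''] = rarr st2 [g, CHR ''A'']"
    by (simp_all add: vec_add_def st1_def st2_def rarr_run)
  then show ?thesis
    using 1 2 3 factors_lincomb[of \<gamma> 1 \<delta>] by (simp add: holds_def)
qed

lemma holds_vec_axpy:
  assumes "ctx st" "holds g \<gamma> st" "holds h \<eta> st" "g \<noteq> h" "\<And>c. [g, c] \<notin> rreads q"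
    and "\<And>i j. rval (st \<lparr> regs := (regs st)(''i'' := i, ''j'' := j) \<rparr>) q = x"
  shows "holds g (\<lambda>ij. \<gamma> ij + x * \<eta> ij) (run (vec_axpy g q h) st)"
  unfolding vec_axpy_def
  by (rule holds_vec_add[OF assms(1,2)])
    (use assms(4-) holdsD[OF assms(3)] in
      \<open>auto simp: right_factor_def left_factor_def sum_distrib_left mult_ac\<close>)

lemma holds_vec_copy:
  assumes "ctx st" "holds h \<eta> st" "g \<noteq> h"
  shows "holds g \<eta> (run (vec_copy g h) st)"
proof -
  let ?st = "run (vec_zero g) st"
  have "holds g (\<lambda>ij. 0 + 1 * \<eta> ij) (run (vec_axpy g (RLit 1) h) ?st)"
  proof (rule holds_vec_axpy)
    show "ctx ?st" by (rule ctx_run) (use assms in auto)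
    show "holds h \<eta> ?st" by (rule holds_run) (use assms in auto)
  qed (use assms in \<open>auto intro: holds_vec_zero\<close>)
  then show ?thesis by (simp add: vec_copy_def)
qed

text \<open>Stored vectors have array names of two characters, so the last assumption separates the
  accumulator from everything that is read.\<close>

lemma rarr_vec_inner:
  assumes "ctx st" "holds g \<gamma> st" "holds h \<eta> st" "\<And>g c. a \<noteq> [g, c]"
  shows "rarr (run (vec_inner a g h) st) a 0 0 = coord_inner I \<gamma> \<eta>"
proof -
  define part where "part = (\<lambda>c n. accumulate [(''i'', Reg n), (''j'', Reg ''r'')] a (ILit 0) (ILit 0)
                    (Mul (cell [g, c]) (cell [h, c])))"
  define st1 where "st1 = run (Store a (ILit 0) (ILit 0) (RLit 0)) st"
  define st2 where "st2 = run (part CHR ''G'' ''r'') st1"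
  define st3 where "st3 = run (part CHR ''A'' ''d2'') st2"
  have w: "writes (part c n) = {a}" "lregs (part c n) = {''i'', ''j''}" for c n
    by (simp_all add: part_def)
  have eq: "run (vec_inner a g h) st = run (part CHR ''B'' ''d1'') st3"
    by (simp add: vec_inner_def part_def st1_def st2_def st3_def)
  have part: "rarr (run (part c n) st') a 0 0 = rarr st' a 0 0 +
      (\<Sum>i<regs st' n. \<Sum>j<regs st' ''r''. rarr st' [g, c] i j * rarr st' [h, c] i j)"
    if "n \<in> {''r'', ''d1'', ''d2''}" for st' c n
    using that assms(4) unfolding part_def by (subst rarr_accumulate) auto
  have regs: "regs st1 n = regs st n" "regs st2 n = regs st n" "regs st3 n = regs st n"
    if "n \<in> {''r'', ''d1'', ''d2''}" for n
    using that by (auto simp: st1_def st2_def st3_def regs_run w)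
  have fr: "rarr st1 [f, c] = rarr st [f, c]" "rarr st2 [f, c] = rarr st [f, c]"
    "rarr st3 [f, c] = rarr st [f, c]" for f c
    using assms(4)[of f c] by (auto simp: st1_def st2_def st3_def rarr_run w)
  have "rarr st1 a 0 0 = 0" by (simp add: st1_def)
  then show ?thesis
    unfolding eq coord_inner_factors
    \<comment> \<open>The definitions of the intermediate states are instantiated at the accumulator
      cell and stay folded everywhere else.\<close>
    by (simp add: part st3_def[THEN arg_cong[where f = "\<lambda>s. rarr s a 0 0"]]
        st2_def[THEN arg_cong[where f = "\<lambda>s. rarr s a 0 0"]] regs fr ctxD[OF assms(1)]
        holdsD[OF assms(2)] holdsD[OF assms(3)])
qed

section \<open>The system operator, the initial vector and the residual\<close>

lemma sample_prog_correct:
  assumes "ctx st" "holds CHR ''P'' \<gamma> st"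
  shows "b < d2 \<Longrightarrow> t < r \<Longrightarrow> rarr (run sample_prog st) ''E'' b t = ext_core \<gamma> b t"
    and "l < length \<Omega> \<Longrightarrow> rarr (run sample_prog st) ''R'' l 0 =
      sample \<Omega> (tangent_map d1 d2 r U V \<gamma>) $ l"
proof -
  define c1 where "c1 = (zero_block ''E'' (Reg ''d2'') (Reg ''r'') ;;
     add_block ''E'' ''d2'' ''r'' (cell ''PA'') ;;
     add_product ''E'' ''d2'' ''r'' ''r'' (Mul (Cell ''PG'' (Reg ''j'') (Reg ''k'')) (Cell ''V'' (Reg ''i'') (Reg ''k''))))"
  define c2 where "c2 = zero_block ''R'' (Reg ''m'') (ILit 1)"
  define c3 where "c3 = accumulate [(''i'', Reg ''m''), (''k'', Reg ''r'')] ''R'' (Reg ''i'') (ILit 0)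
          (Add (Mul (Cell ''U'' (Lookup ''row'' (Reg ''i'')) (Reg ''k''))
                    (Cell ''E'' (Lookup ''col'' (Reg ''i'')) (Reg ''k'')))
               (Mul (Cell ''PB'' (Lookup ''row'' (Reg ''i'')) (Reg ''k''))
                    (Cell ''V'' (Lookup ''col'' (Reg ''i'')) (Reg ''k''))))"
  define st1 where "st1 = run c1 st"
  define st2 where "st2 = run c2 st1"
  have eq: "run sample_prog st = run c3 st2"
    by (simp add: sample_prog_def c1_def c2_def c3_def st1_def st2_def)
  have [simp]: "writes c1 = {''E''}" "writes c2 = {''R''}" "writes c3 = {''R''}"
    "lregs c1 = {''i'', ''j'', ''k''}" "lregs c2 = {''i'', ''j''}"
    by (auto simp: c1_def c2_def c3_def)
  have ctx1: "ctx st1" unfolding st1_def by (rule ctx_run) (use assms(1) in auto)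
  have ctx2: "ctx st2" unfolding st2_def by (rule ctx_run) (use ctx1 in auto)
  have iarr2: "iarr st2 = iarr st" by (simp add: st1_def st2_def)
  have E1: "rarr st1 ''E'' b t = ext_core \<gamma> b t" if "b < d2" "t < r" for b t
    using that assms(1) holdsD[OF assms(2)] unfolding st1_def c1_def
    by (simp add: rarr_updates regs_run ctxD ext_core_def)
  then have E2: "rarr st2 ''E'' b t = ext_core \<gamma> b t" if "b < d2" "t < r" for b t
    using that by (simp add: st2_def rarr_run)
  then show "rarr (run sample_prog st) ''E'' b t = ext_core \<gamma> b t" if "b < d2" "t < r"
    using that by (simp add: eq rarr_run)
  have PB: "rarr st2 ''PB'' a t = left_factor \<gamma> a t" if "a < d1" "t < r" for a t
    using that holdsD[OF assms(2)] by (simp add: st1_def st2_def rarr_run)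
  show "rarr (run sample_prog st) ''R'' l 0 = sample \<Omega> (tangent_map d1 d2 r U V \<gamma>) $ l"
    if l: "l < length \<Omega>"
  proof -
    obtain a b where ab: "\<Omega> ! l = (a,b)" "a < d1" "b < d2"
      using \<Omega>_bounds[OF l] by (cases "\<Omega> ! l") auto
    let ?f = "\<lambda>v k. rarr st2 ''U'' (iarr st ''row'' v) k * rarr st2 ''E'' (iarr st ''col'' v) k +
        rarr st2 ''PB'' (iarr st ''row'' v) k * rarr st2 ''V'' (iarr st ''col'' v) k"
    have "rarr (run sample_prog st) ''R'' l 0 = rarr st2 ''R'' l 0 +
        (\<Sum>v<length \<Omega>. \<Sum>k<r. if v = l then ?f v k else 0)"
      unfolding eq c3_def by (subst rarr_accumulate) (auto simp: ctxD(1-5)[OF ctx2] iarr2 cong: if_cong)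
    also have "(\<Sum>v<length \<Omega>. \<Sum>k<r. if v = l then ?f v k else 0) =
        (\<Sum>v<length \<Omega>. if v = l then \<Sum>k<r. ?f v k else 0)"
      by (intro sum.cong) auto
    also have "\<dots> = (\<Sum>k<r. ?f l k)" using l by simp
    also have "\<dots> = (\<Sum>k<r. U $$ (a,k) * ext_core \<gamma> b k + left_factor \<gamma> a k * V $$ (b,k))"
      using l ab by (intro sum.cong) (auto simp: ctxD[OF ctx2] ctxD[OF assms(1)] E2 PB)
    also have "rarr st2 ''R'' l 0 = 0"
      using l unfolding st2_def c2_def by (simp add: rarr_zero_block ctxD[OF ctx1])
    finally show ?thesis
      using l ab by (simp add: sample_def tangent_map_factors ext_core_def sum.distrib)
  qed
qed

lemma project_prog_correct:
  assumes "ctx st"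
    and F: "\<And>b t. b < d2 \<Longrightarrow> t < r \<Longrightarrow> rarr st ''F'' b t = F b t"
    and K: "\<And>a t. a < d1 \<Longrightarrow> t < r \<Longrightarrow> rarr st ''K'' a t = K a t"
  defines "S \<equiv> \<lambda>i j. \<Sum>b<d2. V $$ (b,j) * F b i" and "L \<equiv> \<lambda>i j. \<Sum>a<d1. U $$ (a,i) * K a j"
  shows "i < r \<Longrightarrow> j < r \<Longrightarrow> rarr (run project_prog st) ''H'' i j = S i j"
    "i < r \<Longrightarrow> j < r \<Longrightarrow> rarr (run project_prog st) ''L'' i j = L i j"
    "i < r \<Longrightarrow> j < r \<Longrightarrow> rarr (run project_prog st) ''WG'' i j = 0"
    "b < d2 \<Longrightarrow> i < r \<Longrightarrow> rarr (run project_prog st) ''WA'' b i =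
       F b i - (\<Sum>j<r. S i j * V $$ (b,j))"
    "a < d1 \<Longrightarrow> j < r \<Longrightarrow> rarr (run project_prog st) ''WB'' a j =
       K a j - (\<Sum>i<r. L i j * U $$ (a,i))"
  unfolding project_prog_def
  using assms(1) F K
  by (simp_all add: rarr_updates vec_zero_def regs_run ctxD S_def L_def sum_negf)

lemma adjoint_prog_correct:
  assumes "ctx st" and R: "\<And>l. l < length \<Omega> \<Longrightarrow> rarr st ''R'' l 0 = w $ l"
  shows "holds CHR ''W'' (coord (sample_adj d1 d2 \<Omega> w)) (run adjoint_prog st)"
proof -
  let ?S = "sample_adj d1 d2 \<Omega> w" and ?n = "length \<Omega>"
  define c1 where "c1 = zero_block ''F'' (Reg ''d2'') (Reg ''r'')"
  define c2 where "c2 = accumulate [(''i'', Reg ''m''), (''j'', Reg ''r'')] ''F''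
     (Lookup ''col'' (Reg ''i'')) (Reg ''j'')
     (Mul (Cell ''R'' (Reg ''i'') (ILit 0)) (Cell ''U'' (Lookup ''row'' (Reg ''i'')) (Reg ''j'')))"
  define c3 where "c3 = zero_block ''K'' (Reg ''d1'') (Reg ''r'')"
  define c4 where "c4 = accumulate [(''i'', Reg ''m''), (''j'', Reg ''r'')] ''K''
     (Lookup ''row'' (Reg ''i'')) (Reg ''j'')
     (Mul (Cell ''R'' (Reg ''i'') (ILit 0)) (Cell ''V'' (Lookup ''col'' (Reg ''i'')) (Reg ''j'')))"
  define st1 where "st1 = run c1 st"
  define st2 where "st2 = run c2 st1"
  define st3 where "st3 = run c3 st2"
  define st4 where "st4 = run c4 st3"
  define st5 where "st5 = run project_prog st4"
  have eq: "run adjoint_prog st = run (add_block ''WG'' ''r'' ''r'' (cell ''H'')) st5"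
    by (simp add: adjoint_prog_def c1_def c2_def c3_def c4_def st1_def st2_def st3_def st4_def st5_def)
  have [simp]: "writes c1 = {''F''}" "writes c2 = {''F''}" "writes c3 = {''K''}" "writes c4 = {''K''}"
    "lregs c1 = {''i'', ''j''}" "lregs c2 = {''i'', ''j''}" "lregs c3 = {''i'', ''j''}" "lregs c4 = {''i'', ''j''}"
    by (auto simp: c1_def c2_def c3_def c4_def)
  have ctx1: "ctx st1" unfolding st1_def by (rule ctx_run) (use assms(1) in auto)
  have ctx2: "ctx st2" unfolding st2_def by (rule ctx_run) (use ctx1 in auto)
  have ctx3: "ctx st3" unfolding st3_def by (rule ctx_run) (use ctx2 in auto)
  have ctx4: "ctx st4" unfolding st4_def by (rule ctx_run) (use ctx3 in auto)
  have ctx5: "ctx st5" unfolding st5_def by (rule ctx_run) (use ctx4 in auto)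
  have R': "rarr st1 ''R'' l 0 = w $ l" "rarr st3 ''R'' l 0 = w $ l" if "l < ?n" for l
    using R[OF that] by (simp_all add: st1_def st2_def st3_def rarr_run)
  have S: "?S $$ (a,b) = (\<Sum>l<?n. if \<Omega> ! l = (a,b) then w $ l else 0)" if "a < d1" "b < d2" for a b
    using that by (simp add: sample_adj_def)
  have F: "rarr st4 ''F'' b t = (\<Sum>a<d1. U $$ (a,t) * ?S $$ (a,b))" if "b < d2" "t < r" for b t
  proof -
    have "rarr st4 ''F'' b t = rarr (run c2 st1) ''F'' b t"
      by (simp add: st2_def st3_def st4_def rarr_run)
    also have "\<dots> = rarr st1 ''F'' b t + (\<Sum>l<?n. \<Sum>j<r.
        if iarr st1 ''col'' l = b \<and> j = t then rarr st1 ''R'' l 0 * rarr st1 ''U'' (iarr st1 ''row'' l) j else 0)"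
      unfolding c2_def by (subst rarr_accumulate) (auto simp: ctxD[OF ctx1] cong: if_cong)
    also have "rarr st1 ''F'' b t = 0"
      using that by (simp add: st1_def c1_def rarr_zero_block ctxD[OF assms(1)])
    also have "(\<Sum>l<?n. \<Sum>j<r.
        if iarr st1 ''col'' l = b \<and> j = t then rarr st1 ''R'' l 0 * rarr st1 ''U'' (iarr st1 ''row'' l) j else 0) =
        (\<Sum>l<?n. \<Sum>a<d1. U $$ (a,t) * (if \<Omega> ! l = (a,b) then w $ l else 0))"
    proof (rule sum.cong[OF refl])
      fix l assume "l \<in> {..<?n}"
      then have l: "l < ?n" by simp
      have "(\<Sum>j<r. if iarr st1 ''col'' l = b \<and> j = t
            then rarr st1 ''R'' l 0 * rarr st1 ''U'' (iarr st1 ''row'' l) j else 0) =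
          (\<Sum>j<r. if j = t then if snd (\<Omega> ! l) = b then w $ l * U $$ (fst (\<Omega> ! l), t) else 0 else 0)"
        using l \<Omega>_bounds[OF l] that by (intro sum.cong) (auto simp: ctxD[OF ctx1] R')
      also have "\<dots> = (if snd (\<Omega> ! l) = b then w $ l * U $$ (fst (\<Omega> ! l), t) else 0)"
        using that by simp
      \<comment> \<open>The row of the sample is turned into a summation index, so that exchanging
        the sums later produces the entries of \<open>?S\<close>.\<close>
      also have "\<dots> = (\<Sum>a<d1. if a = fst (\<Omega> ! l) then if snd (\<Omega> ! l) = b then w $ l * U $$ (a, t) else 0 else 0)"
        using \<Omega>_bounds[OF l] by simp
      also have "\<dots> = (\<Sum>a<d1. U $$ (a,t) * (if \<Omega> ! l = (a,b) then w $ l else 0))"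
        by (intro sum.cong) (auto simp: prod_eq_iff)
      finally show "(\<Sum>j<r. if iarr st1 ''col'' l = b \<and> j = t
            then rarr st1 ''R'' l 0 * rarr st1 ''U'' (iarr st1 ''row'' l) j else 0) =
          (\<Sum>a<d1. U $$ (a,t) * (if \<Omega> ! l = (a,b) then w $ l else 0))" .
    qed
    also have "\<dots> = (\<Sum>a<d1. U $$ (a,t) * ?S $$ (a,b))"
      using that by (subst sum.swap) (simp add: S sum_distrib_left)
    finally show ?thesis by simp
  qed
  have K: "rarr st4 ''K'' a t = (\<Sum>b<d2. V $$ (b,t) * ?S $$ (a,b))" if "a < d1" "t < r" for a t
  proof -
    have "rarr st4 ''K'' a t = rarr st3 ''K'' a t + (\<Sum>l<?n. \<Sum>j<r.
        if iarr st3 ''row'' l = a \<and> j = t then rarr st3 ''R'' l 0 * rarr st3 ''V'' (iarr st3 ''col'' l) j else 0)"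
      unfolding st4_def c4_def by (subst rarr_accumulate) (auto simp: ctxD[OF ctx3] cong: if_cong)
    also have "rarr st3 ''K'' a t = 0"
      using that by (simp add: st3_def c3_def rarr_zero_block ctxD[OF ctx2])
    also have "(\<Sum>l<?n. \<Sum>j<r.
        if iarr st3 ''row'' l = a \<and> j = t then rarr st3 ''R'' l 0 * rarr st3 ''V'' (iarr st3 ''col'' l) j else 0) =
        (\<Sum>l<?n. \<Sum>b<d2. V $$ (b,t) * (if \<Omega> ! l = (a,b) then w $ l else 0))"
    proof (rule sum.cong[OF refl])
      fix l assume "l \<in> {..<?n}"
      then have l: "l < ?n" by simp
      have "(\<Sum>j<r. if iarr st3 ''row'' l = a \<and> j = t
            then rarr st3 ''R'' l 0 * rarr st3 ''V'' (iarr st3 ''col'' l) j else 0) =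
          (\<Sum>j<r. if j = t then if fst (\<Omega> ! l) = a then w $ l * V $$ (snd (\<Omega> ! l), t) else 0 else 0)"
        using l \<Omega>_bounds[OF l] that by (intro sum.cong) (auto simp: ctxD[OF ctx3] R')
      also have "\<dots> = (if fst (\<Omega> ! l) = a then w $ l * V $$ (snd (\<Omega> ! l), t) else 0)"
        using that by simp
      also have "\<dots> = (\<Sum>b<d2. if b = snd (\<Omega> ! l) then if fst (\<Omega> ! l) = a then w $ l * V $$ (b, t) else 0 else 0)"
        using \<Omega>_bounds[OF l] by simp
      also have "\<dots> = (\<Sum>b<d2. V $$ (b,t) * (if \<Omega> ! l = (a,b) then w $ l else 0))"
        by (intro sum.cong) (auto simp: prod_eq_iff)
      finally show "(\<Sum>j<r. if iarr st3 ''row'' l = a \<and> j = t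
            then rarr st3 ''R'' l 0 * rarr st3 ''V'' (iarr st3 ''col'' l) j else 0) =
          (\<Sum>b<d2. V $$ (b,t) * (if \<Omega> ! l = (a,b) then w $ l else 0))" .
    qed
    also have "\<dots> = (\<Sum>b<d2. V $$ (b,t) * ?S $$ (a,b))"
      using that by (subst sum.swap) (simp add: S sum_distrib_left)
    finally show ?thesis by simp
  qed
  have H: "(\<Sum>b<d2. V $$ (b,j) * (\<Sum>a<d1. U $$ (a,i) * ?S $$ (a,b))) = coord ?S (i,j)"
    and L: "(\<Sum>a<d1. U $$ (a,i) * (\<Sum>b<d2. V $$ (b,j) * ?S $$ (a,b))) = coord ?S (i,j)" for i j
    by (simp_all only: coord_alt coord_alt2[symmetric])
  note proj = project_prog_correct[OF ctx4 F K, folded st5_def, unfolded H L]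
  show ?thesis
    unfolding eq holds_def
    by (simp add: rarr_updates ctxD[OF ctx5] proj right_factor_coord left_factor_coord)
qed

lemma weight_prog_correct:
  assumes "ctx st" "holds CHR ''P'' \<gamma> st" "holds CHR ''W'' \<eta> st"
  shows "holds CHR ''W'' (\<lambda>(i,j). \<eta> (i,j) + e\<^sup>2 * inverse (inverse (H i j) - e\<^sup>2) * \<gamma> (i,j)) (run weight_prog st)"
proof -
  let ?\<delta> = "\<lambda>(i,j). e\<^sup>2 * inverse (inverse (H i j) - e\<^sup>2) * \<gamma> (i,j)"
  have "holds CHR ''W'' (\<lambda>ij. \<eta> ij + ?\<delta> ij) (run weight_prog st)"
    unfolding weight_prog_def
    by (rule holds_vec_add[OF assms(1,3)])
      (auto simp: Let_def ctxD[OF assms(1)] holdsD[OF assms(2)] inverse_H max_s power2_eq_square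
        divide_inverse right_factor_def left_factor_def sum_distrib_left mult_ac intro!: sum.cong)
  then show ?thesis by (simp add: case_prod_unfold)
qed

abbreviation "A \<equiv> system_op d1 d2 \<Omega> r e U s V"
abbreviation "rhs \<equiv> system_rhs d1 d2 \<Omega> y U V"

lemma operator_prog_correct:
  assumes "ctx st" "holds CHR ''P'' \<gamma> st"
  shows "holds CHR ''W'' (A \<gamma>) (run operator_prog st)"
proof -
  define st1 where "st1 = run sample_prog st"
  define st2 where "st2 = run adjoint_prog st1"
  have ctx1: "ctx st1" unfolding st1_def by (rule ctx_run) (use assms in auto)
  have ctx2: "ctx st2" unfolding st2_def by (rule ctx_run) (use ctx1 in auto)
  have "holds CHR ''P'' \<gamma> st1" unfolding st1_def by (rule holds_run) (use assms in auto)
  then have P2: "holds CHR ''P'' \<gamma> st2" unfolding st2_def by (rule holds_run) auto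
  have "holds CHR ''W'' (coord (sample_adj d1 d2 \<Omega> (sample \<Omega> (tangent_map d1 d2 r U V \<gamma>)))) st2"
    unfolding st2_def
    by (rule adjoint_prog_correct[OF ctx1]) (simp add: st1_def sample_prog_correct(2)[OF assms])
  from weight_prog_correct[OF ctx2 P2 this] show ?thesis
    by (simp add: operator_prog_def st1_def st2_def system_op_def add.commute case_prod_beta)
qed

text \<open>The input factors need not be orthogonal to the leading vectors. With \<open>S\<close>
  and \<open>L\<close> their contributions to the core, \<open>U_r^T Z = A0^T + L V_r^T\<close>, and
  removing the core \<open>S + L\<close> leaves \<open>A0 - V_r S^T\<close> as right factor, which
  is what the projection computes. The left factor is treated symmetrically.\<close>

lemma load_prog_correct:
  assumes "ctx st"
    and A0: "\<And>b t. b < d2 \<Longrightarrow> t < r \<Longrightarrow> rarr st ''A0'' b t = A0 b t"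
    and B0: "\<And>a t. a < d1 \<Longrightarrow> t < r \<Longrightarrow> rarr st ''B0'' a t = B0 a t"
    and Z: "\<And>a b. a < d1 \<Longrightarrow> b < d2 \<Longrightarrow> tangent_map d1 d2 r U V \<gamma> $$ (a,b) =
      (\<Sum>t<r. U $$ (a,t) * A0 b t) + (\<Sum>t<r. B0 a t * V $$ (b,t))"
  shows "holds CHR ''W'' \<gamma> (run load_prog st)"
proof -
  let ?Z = "tangent_map d1 d2 r U V \<gamma>"
  define S where "S = (\<lambda>i j. \<Sum>b<d2. V $$ (b,j) * A0 b i)"
  define L where "L = (\<lambda>i j. \<Sum>a<d1. U $$ (a,i) * B0 a j)"
  define st1 where "st1 = run (zero_block ''F'' (Reg ''d2'') (Reg ''r'') ;;
     add_block ''F'' ''d2'' ''r'' (cell ''A0'') ;; zero_block ''K'' (Reg ''d1'') (Reg ''r'') ;;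
     add_block ''K'' ''d1'' ''r'' (cell ''B0'')) st"
  define st2 where "st2 = run project_prog st1"
  have eq: "run load_prog st = run (add_block ''WG'' ''r'' ''r'' (Add (cell ''H'') (cell ''L''))) st2"
    by (simp add: load_prog_def st1_def st2_def)
  have ctx1: "ctx st1" unfolding st1_def by (rule ctx_run) (use assms(1) in auto)
  have ctx2: "ctx st2" unfolding st2_def by (rule ctx_run) (use ctx1 in auto)
  have F: "rarr st1 ''F'' b t = A0 b t" if "b < d2" "t < r" for b t
    using that A0 assms(1) by (simp add: st1_def rarr_updates regs_run ctxD)
  have K: "rarr st1 ''K'' a t = B0 a t" if "a < d1" "t < r" for a t
    using that B0 assms(1) by (simp add: st1_def rarr_updates regs_run ctxD)
  have UZ: "(\<Sum>a<d1. U $$ (a,i) * ?Z $$ (a,b)) = A0 b i + (\<Sum>t<r. L i t * V $$ (b,t))"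
    if "i < r" "b < d2" for i b
  proof -
    have "(\<Sum>a<d1. U $$ (a,i) * ?Z $$ (a,b)) =
        (\<Sum>a<d1. U $$ (a,i) * (\<Sum>t<r. A0 b t * U $$ (a,t))) +
        (\<Sum>a<d1. \<Sum>t<r. U $$ (a,i) * B0 a t * V $$ (b,t))"
      using that by (simp add: Z sum.distrib distrib_left sum_distrib_left mult_ac)
    also have "(\<Sum>a<d1. U $$ (a,i) * (\<Sum>t<r. A0 b t * U $$ (a,t))) = A0 b i"
      by (rule sum_orthonormal_left) (use U_cols r_d1 that in auto)
    also have "(\<Sum>a<d1. \<Sum>t<r. U $$ (a,i) * B0 a t * V $$ (b,t)) = (\<Sum>t<r. L i t * V $$ (b,t))"
      unfolding L_def sum_distrib_right by (rule sum.swap)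
    finally show ?thesis .
  qed
  have VZ: "(\<Sum>b<d2. V $$ (b,j) * ?Z $$ (a,b)) = (\<Sum>t<r. S t j * U $$ (a,t)) + B0 a j"
    if "j < r" "a < d1" for j a
  proof -
    have "(\<Sum>b<d2. V $$ (b,j) * ?Z $$ (a,b)) =
        (\<Sum>b<d2. \<Sum>t<r. V $$ (b,j) * A0 b t * U $$ (a,t)) +
        (\<Sum>b<d2. V $$ (b,j) * (\<Sum>t<r. B0 a t * V $$ (b,t)))"
      using that by (simp add: Z sum.distrib distrib_left sum_distrib_left mult_ac)
    also have "(\<Sum>b<d2. V $$ (b,j) * (\<Sum>t<r. B0 a t * V $$ (b,t))) = B0 a j"
      by (rule sum_orthonormal_left) (use V_cols r_d2 that in auto)
    also have "(\<Sum>b<d2. \<Sum>t<r. V $$ (b,j) * A0 b t * U $$ (a,t)) = (\<Sum>t<r. S t j * U $$ (a,t))"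
      unfolding S_def sum_distrib_right by (rule sum.swap)
    finally show ?thesis .
  qed
  have core: "coord ?Z (i,j) = S i j + L i j" if "i < r" "j < r" for i j
  proof -
    have "coord ?Z (i,j) = (\<Sum>b<d2. V $$ (b,j) * A0 b i) +
        (\<Sum>b<d2. V $$ (b,j) * (\<Sum>t<r. L i t * V $$ (b,t)))"
      using that by (simp add: coord_alt2 UZ distrib_left sum.distrib)
    also have "(\<Sum>b<d2. V $$ (b,j) * (\<Sum>t<r. L i t * V $$ (b,t))) = L i j"
      by (rule sum_orthonormal_left) (use V_cols r_d2 that in auto)
    finally show ?thesis by (simp add: S_def)
  qed
  note proj = project_prog_correct[OF ctx1 F K, folded st2_def, folded S_def L_def]
  have "holds CHR ''W'' (coord ?Z) (run load_prog st)"
    unfolding eq holds_def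
    by (simp add: rarr_updates ctxD[OF ctx2] proj right_factor_coord left_factor_coord UZ VZ core
        distrib_right sum.distrib) (simp add: S_def L_def)
  \<comment> \<open>The given coordinates are arbitrary off \<open>I\<close>, where those of
    \<open>?Z\<close> vanish; the stored factors only see \<open>I\<close>.\<close>
  then show ?thesis
    by (rule holds_cong) (use coord_tangent_map in \<open>auto simp: tangent_idx_def\<close>)
qed

lemma residual_prog_correct:
  assumes "ctx st" "holds CHR ''P'' \<gamma> st"
  shows "holds CHR ''Q'' (\<lambda>ij. rhs ij - A \<gamma> ij) (run residual_prog st)"
proof -
  define st1 where "st1 = run operator_prog st"
  define st2 where "st2 = run (vec_zero CHR ''Q'') st1"
  define st3 where "st3 = run (vec_axpy CHR ''Q'' (RLit (- 1)) CHR ''W'') st2"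
  define st4 where "st4 = run (zero_block ''R'' (Reg ''m'') (ILit 1)) st3"
  define st5 where
    "st5 = run (accumulate [(''i'', Reg ''m'')] ''R'' (Reg ''i'') (ILit 0) (Cell ''y'' (Reg ''i'') (ILit 0))) st4"
  define st6 where "st6 = run adjoint_prog st5"
  have ctx1: "ctx st1" unfolding st1_def by (rule ctx_run) (use assms(1) in auto)
  have ctx2: "ctx st2" unfolding st2_def by (rule ctx_run) (use ctx1 in auto)
  have ctx3: "ctx st3" unfolding st3_def by (rule ctx_run) (use ctx2 in auto)
  have ctx4: "ctx st4" unfolding st4_def by (rule ctx_run) (use ctx3 in auto)
  have ctx5: "ctx st5" unfolding st5_def by (rule ctx_run) (use ctx4 in auto)
  have ctx6: "ctx st6" unfolding st6_def by (rule ctx_run) (use ctx5 in auto)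
  have W1: "holds CHR ''W'' (A \<gamma>) st1" unfolding st1_def by (rule operator_prog_correct[OF assms])
  have W2: "holds CHR ''W'' (A \<gamma>) st2" unfolding st2_def by (rule holds_run[OF W1]) auto
  have "holds CHR ''Q'' (\<lambda>ij. 0 + (- 1) * A \<gamma> ij) st3"
    unfolding st3_def
    by (rule holds_vec_axpy[OF ctx2 _ W2]) (auto simp: st2_def intro: holds_vec_zero ctx1)
  then have "holds CHR ''Q'' (\<lambda>ij. 0 + (- 1) * A \<gamma> ij) st4" unfolding st4_def by (rule holds_run) auto
  then have "holds CHR ''Q'' (\<lambda>ij. 0 + (- 1) * A \<gamma> ij) st5" unfolding st5_def by (rule holds_run) auto
  then have Q6: "holds CHR ''Q'' (\<lambda>ij. 0 + (- 1) * A \<gamma> ij) st6" unfolding st6_def by (rule holds_run) auto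
  have "rarr st5 ''R'' l 0 = y $ l" if "l < length \<Omega>" for l
    using that unfolding st5_def
    by (subst rarr_add_rows)
      (auto simp: st4_def rarr_zero_block rarr_run regs_run ctxD[OF ctx3])
  from adjoint_prog_correct[OF ctx5 this] have "holds CHR ''W'' rhs st6"
    by (simp add: st6_def system_rhs_def)
  from holds_vec_axpy[OF ctx6 Q6 this, of "RLit 1" 1]
  have "holds CHR ''Q'' (\<lambda>ij. rhs ij - A \<gamma> ij) (run (vec_axpy CHR ''Q'' (RLit 1) CHR ''W'') st6)"
    by simp
  then show ?thesis
    by (simp add: residual_prog_def st1_def st2_def st3_def st4_def st5_def st6_def)
qed

section \<open>The conjugate gradient loop and the output\<close>

definition cg_holds ::
  "(nat \<times> nat \<Rightarrow> real) \<times> (nat \<times> nat \<Rightarrow> real) \<times> (nat \<times> nat \<Rightarrow> real) \<Rightarrow> mstate \<Rightarrow> bool" where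
  "cg_holds = (\<lambda>(x, q, p) st.
     ctx st \<and> holds CHR ''X'' x st \<and> holds CHR ''Q'' q st \<and> holds CHR ''P'' p st)"

lemma cg_prog_correct:
  assumes "cg_holds (cg_state I A rhs \<gamma>0 n) st"
  shows "cg_holds (cg_state I A rhs \<gamma>0 (Suc n)) (run cg_prog st)"
proof -
  obtain x q p where cg: "cg_state I A rhs \<gamma>0 n = (x, q, p)" by (metis prod_cases3)
  have ctx: "ctx st" and X: "holds CHR ''X'' x st" and Q: "holds CHR ''Q'' q st"
    and P: "holds CHR ''P'' p st"
    using assms by (auto simp: cg_holds_def cg)
  define \<alpha> where "\<alpha> = coord_inner I q q / coord_inner I p (A p)"
  \<comment> \<open>Expressions have no negation, so the program subtracts from zero; the residual
    update is written to match.\<close>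
  define q' where "q' = (\<lambda>i. q i + (0 - \<alpha>) * A p i)"
  define \<beta> where "\<beta> = coord_inner I q' q' / coord_inner I q q"
  define st1 where "st1 = run operator_prog st"
  define st2 where "st2 = run (vec_inner ''rho'' CHR ''Q'' CHR ''Q'') st1"
  define st3 where "st3 = run (vec_inner ''tau'' CHR ''P'' CHR ''W'') st2"
  define st4 where "st4 = run (Store ''alpha'' (ILit 0) (ILit 0) (Div (scal ''rho'') (scal ''tau''))) st3"
  define st5 where "st5 = run (vec_axpy CHR ''X'' (scal ''alpha'') CHR ''P'') st4"
  define st6 where "st6 = run (vec_axpy CHR ''Q'' (Sub (RLit 0) (scal ''alpha'')) CHR ''W'') st5"
  define st7 where "st7 = run (vec_inner ''tau'' CHR ''Q'' CHR ''Q'') st6"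
  define st8 where "st8 = run (Store ''beta'' (ILit 0) (ILit 0) (Div (scal ''tau'') (scal ''rho''))) st7"
  define st9 where "st9 = run (vec_copy CHR ''W'' CHR ''Q'') st8"
  define st10 where "st10 = run (vec_axpy CHR ''W'' (scal ''beta'') CHR ''P'') st9"
  define st11 where "st11 = run (vec_copy CHR ''P'' CHR ''W'') st10"
  have eq: "run cg_prog st = st11"
    unfolding cg_prog_def run.simps(2) st11_def st10_def st9_def st8_def st7_def st6_def st5_def
      st4_def st3_def st2_def st1_def ..
  have ctx1: "ctx st1" unfolding st1_def by (rule ctx_run[OF ctx]) auto
  have ctx2: "ctx st2" unfolding st2_def by (rule ctx_run[OF ctx1]) auto
  have ctx3: "ctx st3" unfolding st3_def by (rule ctx_run[OF ctx2]) auto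
  have ctx4: "ctx st4" unfolding st4_def by (rule ctx_run[OF ctx3]) auto
  have ctx5: "ctx st5" unfolding st5_def by (rule ctx_run[OF ctx4]) auto
  have ctx6: "ctx st6" unfolding st6_def by (rule ctx_run[OF ctx5]) auto
  have ctx7: "ctx st7" unfolding st7_def by (rule ctx_run[OF ctx6]) auto
  have ctx8: "ctx st8" unfolding st8_def by (rule ctx_run[OF ctx7]) auto
  have ctx9: "ctx st9" unfolding st9_def by (rule ctx_run[OF ctx8]) auto
  have ctx10: "ctx st10" unfolding st10_def by (rule ctx_run[OF ctx9]) auto
  have ctx11: "ctx st11" unfolding st11_def by (rule ctx_run[OF ctx10]) auto
  have W1: "holds CHR ''W'' (A p) st1" unfolding st1_def by (rule operator_prog_correct[OF ctx P])
  have X1: "holds CHR ''X'' x st1" unfolding st1_def by (rule holds_run[OF X]) auto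
  have Q1: "holds CHR ''Q'' q st1" unfolding st1_def by (rule holds_run[OF Q]) auto
  have P1: "holds CHR ''P'' p st1" unfolding st1_def by (rule holds_run[OF P]) auto
  have keep4: "holds g \<gamma> st1 \<Longrightarrow> holds g \<gamma> st4" for g \<gamma>
    unfolding st4_def st3_def st2_def by (intro holds_run) auto
  have rho2: "rarr st2 ''rho'' 0 0 = coord_inner I q q"
    unfolding st2_def by (rule rarr_vec_inner[OF ctx1 Q1 Q1]) simp
  have W2: "holds CHR ''W'' (A p) st2" "holds CHR ''P'' p st2"
    unfolding st2_def by (rule holds_run[OF W1] holds_run[OF P1]; auto)+
  have tau3: "rarr st3 ''tau'' 0 0 = coord_inner I p (A p)"
    unfolding st3_def by (rule rarr_vec_inner[OF ctx2 W2(2,1)]) simp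
  have "rarr st3 ''rho'' = rarr st2 ''rho''" by (simp add: st3_def rarr_run)
  then have alpha4: "rarr st4 ''alpha'' 0 0 = \<alpha>"
    by (simp add: st4_def rho2 tau3 \<alpha>_def)
  have X5: "holds CHR ''X'' (\<lambda>i. x i + \<alpha> * p i) st5"
    unfolding st5_def
    by (rule holds_vec_axpy[OF ctx4 keep4[OF X1] keep4[OF P1]]) (auto simp: alpha4)
  have Q5: "holds CHR ''Q'' q st5" "holds CHR ''W'' (A p) st5"
    unfolding st5_def by (rule holds_run[OF keep4[OF Q1]] holds_run[OF keep4[OF W1]]; auto)+
  have "rarr st5 ''alpha'' = rarr st4 ''alpha''" by (simp add: st5_def rarr_run)
  then have Q6: "holds CHR ''Q'' q' st6"
    unfolding st6_def q'_def
    by (intro holds_vec_axpy[OF ctx5 Q5]) (auto simp: alpha4)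
  have tau7: "rarr st7 ''tau'' 0 0 = coord_inner I q' q'"
    unfolding st7_def by (rule rarr_vec_inner[OF ctx6 Q6 Q6]) simp
  have "rarr st7 ''rho'' = rarr st2 ''rho''"
    by (simp add: st7_def st6_def st5_def st4_def st3_def rarr_run)
  then have "rarr st8 ''beta'' 0 0 = \<beta>"
    by (simp add: st8_def rho2 tau7 \<beta>_def)
  then have beta9: "rarr st9 ''beta'' 0 0 = \<beta>"
    by (simp add: st9_def rarr_run)
  have keep8: "holds g \<gamma> st6 \<Longrightarrow> holds g \<gamma> st8" for g \<gamma>
    unfolding st8_def st7_def by (intro holds_run) auto
  have W9: "holds CHR ''W'' q' st9"
    unfolding st9_def by (rule holds_vec_copy[OF ctx8 keep8[OF Q6]]) auto
  have "holds CHR ''P'' p st6"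
    unfolding st6_def st5_def by (intro holds_run keep4 P1) auto
  from keep8[OF this] have P9: "holds CHR ''P'' p st9"
    unfolding st9_def by (rule holds_run) auto
  have W10: "holds CHR ''W'' (\<lambda>i. q' i + \<beta> * p i) st10"
    unfolding st10_def by (rule holds_vec_axpy[OF ctx9 W9 P9]) (auto simp: beta9)
  have P11: "holds CHR ''P'' (\<lambda>i. q' i + \<beta> * p i) st11"
    unfolding st11_def by (rule holds_vec_copy[OF ctx10 W10]) auto
  have Q11: "holds CHR ''Q'' q' st11"
    unfolding st11_def st10_def st9_def by (intro holds_run keep8 Q6) auto
  have "holds CHR ''X'' (\<lambda>i. x i + \<alpha> * p i) st6"
    unfolding st6_def by (rule holds_run[OF X5]) auto
  then have X11: "holds CHR ''X'' (\<lambda>i. x i + \<alpha> * p i) st11"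
    unfolding st11_def st10_def st9_def by (intro holds_run keep8) auto
  have "cg_state I A rhs \<gamma>0 (Suc n) = ((\<lambda>i. x i + \<alpha> * p i), q', (\<lambda>i. q' i + \<beta> * p i))"
    by (simp add: cg Let_def \<alpha>_def \<beta>_def q'_def)
  then show ?thesis
    using ctx11 P11 Q11 X11 by (simp add: eq cg_holds_def)
qed

lemma init_prog_correct:
  assumes "ctx st" "holds CHR ''W'' \<gamma> (run load_prog st)"
  shows "cg_holds (cg_state I A rhs \<gamma> 0) (run init_prog st)"
proof -
  define st1 where "st1 = run load_prog st"
  define st2 where "st2 = run (vec_copy CHR ''P'' CHR ''W'') st1"
  define st3 where "st3 = run (vec_copy CHR ''X'' CHR ''W'') st2"
  define st4 where "st4 = run residual_prog st3"
  define st5 where "st5 = run (vec_copy CHR ''P'' CHR ''Q'') st4"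
  have eq: "run init_prog st = st5"
    by (simp add: init_prog_def st5_def st4_def st3_def st2_def st1_def)
  have ctx1: "ctx st1" unfolding st1_def by (rule ctx_run[OF assms(1)]) (auto simp: load_prog_def)
  have ctx2: "ctx st2" unfolding st2_def by (rule ctx_run[OF ctx1]) auto
  have ctx3: "ctx st3" unfolding st3_def by (rule ctx_run[OF ctx2]) auto
  have ctx4: "ctx st4" unfolding st4_def by (rule ctx_run[OF ctx3]) (auto simp: residual_prog_def)
  have ctx5: "ctx st5" unfolding st5_def by (rule ctx_run[OF ctx4]) auto
  have W1: "holds CHR ''W'' \<gamma> st1" using assms(2) by (simp add: st1_def)
  have P2: "holds CHR ''P'' \<gamma> st2" unfolding st2_def by (rule holds_vec_copy[OF ctx1 W1]) auto
  have W2: "holds CHR ''W'' \<gamma> st2" unfolding st2_def by (rule holds_run[OF W1]) auto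
  have X3: "holds CHR ''X'' \<gamma> st3" unfolding st3_def by (rule holds_vec_copy[OF ctx2 W2]) auto
  have P3: "holds CHR ''P'' \<gamma> st3" unfolding st3_def by (rule holds_run[OF P2]) auto
  have Q4: "holds CHR ''Q'' (\<lambda>ij. rhs ij - A \<gamma> ij) st4"
    unfolding st4_def by (rule residual_prog_correct[OF ctx3 P3])
  have X4: "holds CHR ''X'' \<gamma> st4"
    unfolding st4_def by (rule holds_run[OF X3]) (auto simp: residual_prog_def)
  have "holds CHR ''P'' (\<lambda>ij. rhs ij - A \<gamma> ij) st5"
    unfolding st5_def by (rule holds_vec_copy[OF ctx4 Q4]) auto
  moreover have "holds CHR ''Q'' (\<lambda>ij. rhs ij - A \<gamma> ij) st5"
    unfolding st5_def by (rule holds_run[OF Q4]) auto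
  moreover have "holds CHR ''X'' \<gamma> st5"
    unfolding st5_def by (rule holds_run[OF X4]) auto
  ultimately show ?thesis using ctx5 by (simp add: eq cg_holds_def)
qed

lemma output_prog_correct:
  assumes "ctx st" "holds CHR ''X'' x st"
  shows "l < length \<Omega> \<Longrightarrow> rarr (run output_prog st) ''res'' l 0 =
      y $ l - sample \<Omega> (tangent_map d1 d2 r U V x) $ l"
    and "b < d2 \<Longrightarrow> t < r \<Longrightarrow> rarr (run output_prog st) ''M1'' b t = ext_core x b t"
    and "a < d1 \<Longrightarrow> t < r \<Longrightarrow> rarr (run output_prog st) ''M2'' a t = left_factor x a t"
proof -
  define st1 where "st1 = run (vec_copy CHR ''P'' CHR ''X'') st"
  define st2 where "st2 = run sample_prog st1"
  define st3 where "st3 = run (zero_block ''res'' (Reg ''m'') (ILit 1) ;;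
     accumulate [(''i'', Reg ''m'')] ''res'' (Reg ''i'') (ILit 0)
       (Sub (Cell ''y'' (Reg ''i'') (ILit 0)) (Cell ''R'' (Reg ''i'') (ILit 0)))) st2"
  have eq: "run output_prog st = run (zero_block ''M1'' (Reg ''d2'') (Reg ''r'') ;;
     add_block ''M1'' ''d2'' ''r'' (cell ''E'') ;;
     zero_block ''M2'' (Reg ''d1'') (Reg ''r'') ;;
     add_block ''M2'' ''d1'' ''r'' (cell ''PB'')) st3"
    by (simp add: output_prog_def st3_def st2_def st1_def)
  have ctx1: "ctx st1" unfolding st1_def by (rule ctx_run[OF assms(1)]) auto
  have ctx2: "ctx st2" unfolding st2_def by (rule ctx_run[OF ctx1]) auto
  have ctx3: "ctx st3" unfolding st3_def by (rule ctx_run[OF ctx2]) auto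
  have P1: "holds CHR ''P'' x st1" unfolding st1_def by (rule holds_vec_copy[OF assms]) auto
  then have P2: "holds CHR ''P'' x st2" unfolding st2_def by (rule holds_run) auto
  then have P3: "holds CHR ''P'' x st3" unfolding st3_def by (rule holds_run) auto
  note sampled = sample_prog_correct[OF ctx1 P1, folded st2_def]
  have "rarr st3 ''res'' l 0 = y $ l - sample \<Omega> (tangent_map d1 d2 r U V x) $ l"
    if "l < length \<Omega>"
    using that unfolding st3_def run.simps(2)
    by (subst rarr_add_rows)
      (auto simp: rarr_zero_block rarr_run regs_run ctxD[OF ctx2] sampled(2))
  then show "l < length \<Omega> \<Longrightarrow> rarr (run output_prog st) ''res'' l 0 =
      y $ l - sample \<Omega> (tangent_map d1 d2 r U V x) $ l"
    by (simp add: eq rarr_run)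
  have "rarr st3 ''E'' = rarr st2 ''E''" by (simp add: st3_def rarr_run)
  then show "b < d2 \<Longrightarrow> t < r \<Longrightarrow> rarr (run output_prog st) ''M1'' b t = ext_core x b t"
    by (simp add: eq rarr_updates regs_run ctxD[OF ctx3] sampled(1))
  show "a < d1 \<Longrightarrow> t < r \<Longrightarrow> rarr (run output_prog st) ''M2'' a t = left_factor x a t"
    by (simp add: eq rarr_updates regs_run ctxD[OF ctx3] holdsD[OF P3])
qed

lemma step_prog_correct:
  assumes "ctx st" "holds CHR ''W'' \<gamma>0 (run load_prog st)"
  defines "x \<equiv> cg_iterate I A rhs \<gamma>0 N"
  shows "l < length \<Omega> \<Longrightarrow> rarr (run step_prog st) ''res'' l 0 =
      y $ l - sample \<Omega> (tangent_map d1 d2 r U V x) $ l"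
    and "b < d2 \<Longrightarrow> t < r \<Longrightarrow> rarr (run step_prog st) ''M1'' b t = ext_core x b t"
    and "a < d1 \<Longrightarrow> t < r \<Longrightarrow> rarr (run step_prog st) ''M2'' a t = left_factor x a t"
proof -
  let ?st = "run init_prog st"
  have init: "cg_holds (cg_state I A rhs \<gamma>0 0) ?st" by (rule init_prog_correct[OF assms(1,2)])
  have N: "ival ?st (Reg ''N'') = N"
    using init by (auto simp: cg_holds_def ctxD)
  have tick: "cg_holds c (tick n (st' \<lparr> regs := (regs st')(''n'' := v) \<rparr>))" if "cg_holds c st'" for c n v st'
    using that by (auto simp: cg_holds_def holds_tick ctx_tick)
  have "cg_holds (cg_state I A rhs \<gamma>0 (ival ?st (Reg ''N''))) (run (For ''n'' (Reg ''N'') cg_prog) ?st)"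
  proof (rule run_For_induct)
    \<comment> \<open>The fact \<open>tick\<close> speaks of states with a reassigned counter.
      Giving \<open>n\<close> its present value brings the initial state into that form.\<close>
    have "tick k ?st = tick k (?st \<lparr> regs := (regs ?st)(''n'' := regs ?st ''n'') \<rparr>)" for k by simp
    then show "cg_holds (cg_state I A rhs \<gamma>0 0) (tick (1 + icost (Reg ''N'')) ?st)"
      using tick[OF init] by metis
  qed (intro cg_prog_correct tick)
  then have "cg_holds (cg_state I A rhs \<gamma>0 N) (run (For ''n'' (Reg ''N'') cg_prog) ?st)"
    unfolding N .
  then have *: "ctx (run (For ''n'' (Reg ''N'') cg_prog) ?st)"
    "holds CHR ''X'' x (run (For ''n'' (Reg ''N'') cg_prog) ?st)"
    by (auto simp: cg_holds_def x_def cg_iterate_def)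
  have eq: "run step_prog st = run output_prog (run (For ''n'' (Reg ''N'') cg_prog) ?st)"
    unfolding step_prog_def run.simps(2) ..
  show "l < length \<Omega> \<Longrightarrow> rarr (run step_prog st) ''res'' l 0 =
      y $ l - sample \<Omega> (tangent_map d1 d2 r U V x) $ l"
    "b < d2 \<Longrightarrow> t < r \<Longrightarrow> rarr (run step_prog st) ''M1'' b t = ext_core x b t"
    "a < d1 \<Longrightarrow> t < r \<Longrightarrow> rarr (run step_prog st) ''M2'' a t = left_factor x a t"
    unfolding eq by (rule output_prog_correct[OF *]; assumption)+
qed

section \<open>Resources\<close>

lemma static_progs:
  "bregs step_prog \<inter> lregs step_prog = {}"
  by (simp add: step_prog_unfold)

text \<open>One application of the operator stays within \<open>M\<close>, lower powers of
  \<open>r\<close> being absorbed by \<open>1 \<le> r\<close> and core loops by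
  \<open>r \<le> max d1 d2\<close>. Setup and output are absorbed by
  \<open>1 \<le> N\<close>.\<close>

lemma steps_step_prog:
  assumes "ctx st" "1 \<le> r" "1 \<le> N"
  shows "steps (run step_prog st) \<le>
    steps st + cost_const step_prog * ((length \<Omega> * r + r\<^sup>2 * max d1 d2) * N)"
proof -
  define M where "M = length \<Omega> * r + r\<^sup>2 * max d1 d2"
  have r: "r \<le> r * r" using assms(2) by simp
  have D: "r \<le> max d1 d2" using r_d1 by simp
  have "loops_within st 1 (M * N) step_prog"
  proof -
    have sq: "r * r * k \<le> M" if "k \<le> max d1 d2" for k
      using that by (simp add: M_def power2_eq_square trans_le_add2)
    have lin: "r * k \<le> M" if "k \<le> max d1 d2" for k
      using sq[OF that] r mult_le_mono1[OF r, of k] by linarith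
    have m: "length \<Omega> * r \<le> M" "length \<Omega> \<le> M"
      using assms(2) by (simp_all add: M_def trans_le_add1)
    have one: "k \<le> M" if "k \<le> max d1 d2" for k
      using lin[OF that] mult_le_mono1[OF assms(2), of k] by linarith
    have monoms: "1 \<le> M" "r \<le> M" "d1 \<le> M" "d2 \<le> M" "r * r \<le> M" "r * d1 \<le> M" "r * d2 \<le> M"
      "d1 * r \<le> M" "d2 * r \<le> M" "r * r * r \<le> M" "r * r * d1 \<le> M" "r * r * d2 \<le> M"
      "d1 * r * r \<le> M" "d2 * r * r \<le> M"
      using one[of 1] one[of r] one[of d1] one[of d2] lin[of r] lin[of d1] lin[of d2]
        sq[of r] sq[of d1] sq[of d2] D assms(2)
      by (auto simp: mult_ac)
    \<comment> \<open>\<open>outer\<close> is for loops before and after the conjugate gradient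
      loop, \<open>inner\<close> for those within it, whose products carry the factor
      \<open>N\<close>.\<close>
    have outer: "k \<le> M * N" if "k \<le> M" for k
      using that assms(3) mult_le_mono[OF that assms(3)] by simp
    have inner: "N * k \<le> M * N" if "k \<le> M" for k
      using that by (simp add: mult.commute)
    note bounds = monoms[THEN outer] m[THEN outer] monoms[THEN inner] m[THEN inner]
    show ?thesis
      using bounds ctxD(1-5)[OF assms(1)]
      by (simp add: step_prog_unfold mult_ac)
  qed
  then show ?thesis
    unfolding M_def[symmetric]
    using static_cost_le[of st 1 "M * N" step_prog] steps_run[OF static_progs] by simp
qed

text \<open>A coarse layout: arrays indexed by samples get one column, and every other array,
  scalars included, gets a full rectangle. Since the number of arrays is fixed, the order of the
  bound is unaffected.\<close>

definition room :: "string \<Rightarrow> (nat \<times> nat) set" where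
  "room a = (if a \<in> {''y'', ''res'', ''R''} then {..<length \<Omega>} \<times> {..<1} else {..<max d1 d2} \<times> {..<r})"

definition reg_range :: "string \<Rightarrow> nat set" where
  "reg_range x = (if x = ''d1'' then {d1} else if x = ''d2'' then {d2} else if x = ''m'' then {length \<Omega>}
     else if x = ''r'' then {r} else if x = ''N'' then {N} else UNIV)"

text \<open>These are the address sets in the form in which \<open>cells_ok\<close> produces them.
  The images under \<open>row\<close> and \<open>col\<close> come from the scattered
  updates.\<close>

lemma room_simps:
  assumes "iarr st ''row'' ` {..<length \<Omega>} \<subseteq> {..<max d1 d2}"
    "iarr st ''col'' ` {..<length \<Omega>} \<subseteq> {..<max d1 d2}" "0 < r"
  shows "{..<length \<Omega>} \<times> {..<Suc 0} \<subseteq> room ''R''" "{..<length \<Omega>} \<times> {..<Suc 0} \<subseteq> room ''res''"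
    "{..<length \<Omega>} \<times> {0} \<subseteq> room ''R''" "{..<length \<Omega>} \<times> {0} \<subseteq> room ''res''"
    "a \<notin> {''y'', ''res'', ''R''} \<Longrightarrow> (0, 0) \<in> room a"
    "a \<notin> {''y'', ''res'', ''R''} \<Longrightarrow> {..<r} \<times> {..<r} \<subseteq> room a"
    "a \<notin> {''y'', ''res'', ''R''} \<Longrightarrow> {..<d1} \<times> {..<r} \<subseteq> room a"
    "a \<notin> {''y'', ''res'', ''R''} \<Longrightarrow> {..<d2} \<times> {..<r} \<subseteq> room a"
    "a \<notin> {''y'', ''res'', ''R''} \<Longrightarrow> iarr st ''row'' ` {..<length \<Omega>} \<times> {..<r} \<subseteq> room a"
    "a \<notin> {''y'', ''res'', ''R''} \<Longrightarrow> iarr st ''col'' ` {..<length \<Omega>} \<times> {..<r} \<subseteq> room a"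
proof -
  have "0 < d1" "0 < d2" using assms(3) r_d1 r_d2 by linarith+
  show "{..<length \<Omega>} \<times> {..<Suc 0} \<subseteq> room ''R''" "{..<length \<Omega>} \<times> {..<Suc 0} \<subseteq> room ''res''"
    "{..<length \<Omega>} \<times> {0} \<subseteq> room ''R''" "{..<length \<Omega>} \<times> {0} \<subseteq> room ''res''"
    by (auto simp: room_def)
  assume a: "a \<notin> {''y'', ''res'', ''R''}"
  then have room: "room a = {..<max d1 d2} \<times> {..<r}" by (simp add: room_def)
  show "(0, 0) \<in> room a" using assms(3) \<open>0 < d1\<close> by (simp add: room less_max_iff_disj)
  show "{..<r} \<times> {..<r} \<subseteq> room a" "{..<d1} \<times> {..<r} \<subseteq> room a" "{..<d2} \<times> {..<r} \<subseteq> room a"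
    "iarr st ''row'' ` {..<length \<Omega>} \<times> {..<r} \<subseteq> room a"
    "iarr st ''col'' ` {..<length \<Omega>} \<times> {..<r} \<subseteq> room a"
    unfolding room by (intro Sigma_mono; use assms r_d1 in auto)+
qed
lemma cells_step_prog:
  assumes "ctx st" "1 \<le> r"
  shows "cells (run step_prog st) \<subseteq> cells st \<union> Sigma (writes step_prog) room"
proof -
  have "iarr st ''row'' ` {..<length \<Omega>} \<subseteq> {..<max d1 d2}"
    "iarr st ''col'' ` {..<length \<Omega>} \<subseteq> {..<max d1 d2}" "0 < r"
    using \<Omega>_bounds assms(2) by (auto simp: ctxD[OF assms(1)] less_max_iff_disj)
  note room = room_simps[OF this]
  have "cells_ok (iarr st) room reg_range step_prog"
    by (simp add: step_prog_unfold reg_range_def room)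
  moreover have "regs st x \<in> reg_range x" for x
    using ctxD(1-5)[OF assms(1)] by (auto simp: reg_range_def)
  ultimately show ?thesis using cells_run by blast
qed

lemma card_cells_step_prog:
  assumes "ctx st" "1 \<le> r"
    and "cells st = block ''y'' (length \<Omega>) 1 \<union> block ''eps'' 1 1 \<union> block ''sigma'' r 1 \<union>
       block ''U'' d1 r \<union> block ''V'' d2 r \<union> block ''A0'' d2 r \<union> block ''B0'' d1 r"
  shows "card (cells (run step_prog st)) \<le>
    (card (writes step_prog) + 7) * (length \<Omega> + r * max d1 d2)"
proof -
  \<comment> \<open>These names of the input arrays account for the 7 in the bound.\<close>
  let ?in = "{''y'', ''eps'', ''sigma'', ''U'', ''V'', ''A0'', ''B0''}"
  let ?R = "{..<length \<Omega>} \<times> {..<1::nat} \<union> {..<max d1 d2} \<times> {..<r}"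
  have "cells st \<subseteq> ?in \<times> ?R"
    using assms(2) r_d1 by (auto simp: assms(3) block_def)
  moreover have "Sigma (writes step_prog) room \<subseteq> writes step_prog \<times> ?R"
    by (auto simp: room_def split: if_splits)
  ultimately have "cells st \<union> Sigma (writes step_prog) room \<subseteq> (writes step_prog \<union> ?in) \<times> ?R"
    unfolding Sigma_Un_distrib1 by (meson Un_least le_supI1 le_supI2)
  then have "cells (run step_prog st) \<subseteq> (writes step_prog \<union> ?in) \<times> ?R"
    by (rule order_trans[OF cells_step_prog[OF assms(1,2)]])
  then have "card (cells (run step_prog st)) \<le> card ((writes step_prog \<union> ?in) \<times> ?R)"
    by (intro card_mono) auto
  also have "\<dots> = card (writes step_prog \<union> ?in) * card ?R"
    by (rule card_cartesian_product)
  also have "\<dots> \<le> (card (writes step_prog) + 7) * (length \<Omega> + r * max d1 d2)"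
  proof (rule mult_le_mono)
    have "card (writes step_prog \<union> ?in) \<le> card (writes step_prog) + card ?in" by (rule card_Un_le)
    also have "card ?in \<le> 7" by simp
    finally show "card (writes step_prog \<union> ?in) \<le> card (writes step_prog) + 7" by simp
    have "card ?R \<le> card ({..<length \<Omega>} \<times> {..<1::nat}) + card ({..<max d1 d2} \<times> {..<r})"
      by (rule card_Un_le)
    then show "card ?R \<le> length \<Omega> + r * max d1 d2"
      by (simp add: card_cartesian_product mult.commute)
  qed
  finally show ?thesis .
qed

end

section \<open>Assembly with a uniform program and constant\<close>

theorem theorem3p1:
  shows "\<exists>(prog :: cmd) (C :: real).
    \<forall>(d1::nat) (d2::nat) (m::nat) (r::nat) (k::nat) (\<Omega> :: (nat \<times> nat) list) (y :: real vec)
     (X :: nat \<Rightarrow> real mat) (eps :: nat \<Rightarrow> ereal)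
     (U :: nat \<Rightarrow> real mat) (s :: nat \<Rightarrow> nat \<Rightarrow> real) (V :: nat \<Rightarrow> real mat).
      length \<Omega> = m \<and> distinct \<Omega> \<and> set \<Omega> \<subseteq> {..<d1} \<times> {..<d2} \<and> y \<in> carrier_vec m \<and>
      1 \<le> r \<and> 1 \<le> k \<and>
      matrix_irls d1 d2 \<Omega> y r k X eps U s V \<and>
      (\<forall>i\<ge>r. ereal (s k i) \<le> eps k) \<and> eps k < ereal (s k (r - 1))
      \<longrightarrow>
      (let D = max d1 d2;
           e = real_of_ereal (eps k);
           Ur = first_cols r (U k);
           Vr = first_cols r (V k);
           rk = num_above d1 d2 e (s k);
           I = tangent_idx d1 d2 rk;
           A = system_op d1 d2 \<Omega> rk e (U k) (s k) (V k);
           b = system_rhs d1 d2 \<Omega> y (U k) (V k)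
       in
        (\<exists>\<rho>\<in>carrier_vec m. \<exists>M1\<in>carrier_mat d2 r. \<exists>M2\<in>carrier_mat d1 r.
           X (k + 1) = sample_adj d1 d2 \<Omega> \<rho> + Ur * M1\<^sup>T + M2 * Vr\<^sup>T) \<and>
        real (m + d2 * r + d1 * r) \<le> C * real (m + r * D) \<and>
        (\<forall>N\<ge>1. \<forall>\<gamma>0. \<forall>A0\<in>carrier_mat d2 r. \<forall>B0\<in>carrier_mat d1 r. \<forall>st.
           tangent_map d1 d2 rk (U k) (V k) \<gamma>0 = Ur * A0\<^sup>T + B0 * Vr\<^sup>T \<and>
           step_input d1 d2 r N \<Omega> y e (s k) Ur Vr A0 B0 st
           \<longrightarrow>
           (let \<gamma> = cg_iterate I A b \<gamma>0 N;
                out = run prog st;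
                \<rho> = read_vec out ''res'' m;
                M1 = read_mat out ''M1'' d2 r;
                M2 = read_mat out ''M2'' d1 r;
                Xnew = sample_adj d1 d2 \<Omega> \<rho> + Ur * M1\<^sup>T + M2 * Vr\<^sup>T
            in
              Xnew = matrix_of_coords d1 d2 \<Omega> y rk (U k) (V k) \<gamma> \<and>
              ((\<forall>p\<in>I. A \<gamma> p = b p) \<longrightarrow> X (k + 1) = Xnew) \<and>
              real (steps out) \<le> C * real ((m * r + r\<^sup>2 * D) * N) \<and>
              real (card (cells out)) \<le> C * real (m + r * D))))"
proof -
  \<comment> \<open>One constant for three bounds: the first summand pays for time, the others count
    written and input arrays for space, and the 7 also exceeds the factor 2 in the size of the
    representation.\<close>
  define c where "c = cost_const step_prog + card (writes step_prog) + 7"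
  show ?thesis
  proof (intro exI[of _ step_prog] exI[of _ "real c"] allI impI, elim conjE, goal_cases)
    case (1 d1 d2 m r k \<Omega> y X eps U s V)
    define e where "e = real_of_ereal (eps k)"
    have "k \<in> {1..k}" using 1(6) by simp
    note step = bspec[OF conjunct2[OF conjunct2[OF 1(7)[unfolded matrix_irls_def]]] this]
    have irls: "is_svd d1 d2 (X k) (U k) (s k) (V k)" "eps k = min (eps (k - 1)) (ereal (s k r))"
      "0 < eps k"
      "wls_minimizer d1 d2 \<Omega> y (weight_op d1 d2 e (U k) (s k) (V k)) (X (k + 1))"
      using step unfolding e_def by blast+
    \<comment> \<open>The minimum with a real singular value is below infinity whatever the previous
      smoothing parameter was, and positivity excludes the other infinity.\<close>
    have "eps k \<noteq> \<infinity>" "eps k \<noteq> - \<infinity>" using irls(2,3) by (auto simp: min_def split: if_splits)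
    then have eps: "eps k = ereal e" by (auto simp: e_def ereal_real)
    have anti: "antimono (s k)" and zero: "\<And>i. min d1 d2 \<le> i \<Longrightarrow> s k i = 0"
      using irls(1) by (auto simp: is_svd_def)
    have e: "0 < e" and low: "\<And>i. r \<le> i \<Longrightarrow> s k i \<le> e" and "e < s k (r - 1)"
      using irls(3) 1(8,9) by (auto simp: eps)
    have high: "e < s k i" if "i < r" for i
      using antimonoD[OF anti, of i "r - 1"] that \<open>e < s k (r - 1)\<close> by linarith
    \<comment> \<open>The padded singular values are zero, so one that exceeds \<open>e > 0\<close>
      has an index below \<open>min d1 d2\<close>. This yields both bounds on the rank.\<close>
    have "r - 1 < min d1 d2" using zero[of "r - 1"] \<open>e < s k (r - 1)\<close> e by (metis less_asym not_le)
    then have r: "r \<le> d1" "r \<le> d2" by auto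
    \<comment> \<open>The system is built with the counted rank, the program runs with the estimate
      \<open>r\<close>; the gap at \<open>e\<close> identifies the two.\<close>
    have "{i. i < min d1 d2 \<and> e < s k i} = {..<r}"
      using r high low by (auto simp: not_less[symmetric])
    then have rk: "num_above d1 d2 e (s k) = r" by (simp add: num_above_def)
    interpret weighted_bases d1 d2 r "U k" "V k" e "s k"
      using irls(1) r e low high by unfold_locales (auto simp: is_svd_def)
    have Ur: "first_cols r (U k) \<in> carrier_mat d1 r" and Vr: "first_cols r (V k) \<in> carrier_mat d2 r"
      by (auto simp: first_cols_def)
    obtain \<rho> g where rep: "\<rho> \<in> carrier_vec (length \<Omega>)"
      "X (k + 1) = sample_adj d1 d2 \<Omega> \<rho> + tangent_map d1 d2 r (U k) (V k) g"
      using minimizer_representation[OF irls(4) 1(2,3)] by blast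
    have assoc: "sample_adj d1 d2 \<Omega> \<rho> + tangent_map d1 d2 r (U k) (V k) g =
        sample_adj d1 d2 \<Omega> \<rho> + first_cols r (U k) * (mat d2 r (\<lambda>(b,t). ext_core g b t))\<^sup>T +
        mat d1 r (\<lambda>(a,t). left_factor g a t) * (first_cols r (V k))\<^sup>T" for \<rho> g
      unfolding tangent_map_product
      by (rule assoc_add_mat[symmetric, OF sample_adj_carrier]) (use Ur Vr in auto)
    show ?case
      unfolding Let_def e_def[symmetric] rk
    proof (intro conjI allI ballI impI; (elim conjE)?)
      show "\<exists>\<rho>\<in>carrier_vec m. \<exists>M1\<in>carrier_mat d2 r. \<exists>M2\<in>carrier_mat d1 r. X (k + 1) =
          sample_adj d1 d2 \<Omega> \<rho> + first_cols r (U k) * M1\<^sup>T + M2 * (first_cols r (V k))\<^sup>T"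
      proof (intro bexI)
        show "X (k + 1) = sample_adj d1 d2 \<Omega> \<rho> +
            first_cols r (U k) * (mat d2 r (\<lambda>(b,t). ext_core g b t))\<^sup>T +
            mat d1 r (\<lambda>(a,t). left_factor g a t) * (first_cols r (V k))\<^sup>T"
          unfolding rep(2) by (rule assoc)
      qed (use rep(1) 1(1) in auto)
      have "m + d2 * r + d1 * r \<le> m + r * max d1 d2 + r * max d1 d2"
        by (intro add_mono) simp_all
      then have "m + d2 * r + d1 * r \<le> 2 * (m + r * max d1 d2)" by simp
      also have "\<dots> \<le> c * (m + r * max d1 d2)" by (intro mult_le_mono1) (simp add: c_def)
      finally show "real (m + d2 * r + d1 * r) \<le> real c * real (m + r * max d1 d2)"
        unfolding of_nat_mult[symmetric] by (simp only: of_nat_le_iff)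
    next
      fix N \<gamma>0 A0 B0 st
      assume N: "1 \<le> N" and A0: "A0 \<in> carrier_mat d2 r" and B0: "B0 \<in> carrier_mat d1 r"
        and init: "tangent_map d1 d2 r (U k) (V k) \<gamma>0 = first_cols r (U k) * A0\<^sup>T + B0 * (first_cols r (V k))\<^sup>T"
        and st: "step_input d1 d2 r N \<Omega> y e (s k) (first_cols r (U k)) (first_cols r (V k)) A0 B0 st"
      interpret irls_step d1 d2 r "U k" "V k" e "s k" \<Omega> y N
        using 1(1,3,4) by unfold_locales auto
      have ctx: "ctx st"
        using st y unfolding ctx_def step_input_def
        by (auto simp: holds_vec_def holds_mat_def first_cols_def)
      have load: "holds CHR ''W'' \<gamma>0 (run load_prog st)"
      proof (rule load_prog_correct[OF ctx, of "\<lambda>b t. A0 $$ (b,t)" "\<lambda>a t. B0 $$ (a,t)"])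
        show "rarr st ''A0'' b t = A0 $$ (b,t)" if "b < d2" "t < r" for b t
          using st A0 that by (auto simp: step_input_def holds_mat_def)
        show "rarr st ''B0'' a t = B0 $$ (a,t)" if "a < d1" "t < r" for a t
          using st B0 that by (auto simp: step_input_def holds_mat_def)
        show "tangent_map d1 d2 r (U k) (V k) \<gamma>0 $$ (a,b) =
            (\<Sum>t<r. U k $$ (a,t) * A0 $$ (b,t)) + (\<Sum>t<r. B0 $$ (a,t) * V k $$ (b,t))"
          if "a < d1" "b < d2" for a b
          unfolding init using A0 B0 that
          by (simp add: first_cols_def scalar_prod_def atLeast0LessThan)
      qed
      let ?\<gamma> = "cg_iterate I A rhs \<gamma>0 N" and ?out = "run step_prog st"
      let ?X = "sample_adj d1 d2 \<Omega> (read_vec ?out ''res'' m) +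
        first_cols r (U k) * (read_mat ?out ''M1'' d2 r)\<^sup>T + read_mat ?out ''M2'' d1 r * (first_cols r (V k))\<^sup>T"
      note out = step_prog_correct[OF ctx load]
      have "read_vec ?out ''res'' m = y - sample \<Omega> (tangent_map d1 d2 r (U k) (V k) ?\<gamma>)"
        by (rule eq_vecI) (use 1(1) out(1) in \<open>auto simp: read_vec_def sample_def\<close>)
      moreover have "read_mat ?out ''M1'' d2 r = mat d2 r (\<lambda>(b,t). ext_core ?\<gamma> b t)"
        by (rule eq_matI) (auto simp: read_mat_def out(2))
      moreover have "read_mat ?out ''M2'' d1 r = mat d1 r (\<lambda>(a,t). left_factor ?\<gamma> a t)"
        by (rule eq_matI) (auto simp: read_mat_def out(3))
      ultimately show X: "?X = matrix_of_coords d1 d2 \<Omega> y r (U k) (V k) ?\<gamma>"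
        by (simp add: matrix_of_coords_def assoc)
      show "X (k + 1) = ?X" if "\<forall>p\<in>I. A ?\<gamma> p = rhs p"
        unfolding X using that by (intro minimizer_from_system[OF irls(4) 1(2,3) y]) auto
      have "steps st = 0" using st by (simp add: step_input_def)
      then have "steps ?out \<le> cost_const step_prog * ((m * r + r\<^sup>2 * max d1 d2) * N)"
        using steps_step_prog[OF ctx 1(5) N] 1(1) by simp
      also have "\<dots> \<le> c * ((m * r + r\<^sup>2 * max d1 d2) * N)"
        by (intro mult_le_mono1) (simp add: c_def)
      finally show "real (steps ?out) \<le> real c * real ((m * r + r\<^sup>2 * max d1 d2) * N)"
        unfolding of_nat_mult[symmetric] by (simp only: of_nat_le_iff)
      have "card (cells ?out) \<le> (card (writes step_prog) + 7) * (m + r * max d1 d2)"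
        using card_cells_step_prog[OF ctx 1(5)] st 1(1) by (simp add: step_input_def)
      also have "\<dots> \<le> c * (m + r * max d1 d2)"
        by (intro mult_le_mono1) (simp add: c_def)
      finally show "real (card (cells ?out)) \<le> real c * real (m + r * max d1 d2)"
        unfolding of_nat_mult[symmetric] by (simp only: of_nat_le_iff)
    qed
  qed
qed

end
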